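(* Let $\mathfrak{g}$ be a finite dimensional simple complex Lie algebra, $\sigma$ a Coxeter automorphism of $\mathfrak{g}$ of order $m$, and $\gamma=\sum_{j=0}^{m-1}\gamma_j$ the decomposition of the Casimir element with $\gamma_j\in\mathfrak{g}_j\otimes\mathfrak{g}_{-j}$. Let $$r(x,y)=\frac{y^m}{x^m-y^m}\sum_{j=0}^{m-1}\Bigl(\frac xy\Bigr)^j\gamma_j+g(x,y)$$ be a solution of the classical Yang–Baxter equation $$\begin{cases}[r^{12}(x_1,x_2),r^{13}(x_1,x_3)]+[r^{13}(x_1,x_3),r^{23}(x_2,x_3)]+[r^{12}(x_1,x_2),r^{23}(x_2,x_3)]=0,\\ r^{12}(x_1,x_2)=-r^{21}(x_2,x_1),\end{cases}$$ where $g:\mathbb{C}^2\to\mathfrak{g}\otimes\mathfrak{g}$ is a holomorphic function. Then $r$ is equivalent to a trigonometric solution $\varrho$ of the classical Yang–Baxter equation with one spectral parameter.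
   Context: $\mathfrak{g}_j=\{a\in\mathfrak{g}\,|\,\sigma(a)=\exp(2\pi ij/m)a\}$; the Casimir element is taken with respect to the Killing form. A Coxeter automorphism of $\mathfrak{g}$, attached to an automorphism $\phi$ of the Dynkin diagram, is the finite-order automorphism in the outer class of $\phi$ of type $(1,\dots,1;\mathrm{ord}(\phi))$ in Kac's classification. Equivalence is generated by gauge transformations $r(x,y)\mapsto(\phi(x)\otimes\phi(y))r(x,y)$, with $\phi$ a germ of a holomorphic function with values in $\mathrm{Aut}_{\mathbb{C}}(\mathfrak{g})$, and changes of variables $r(x,y)\mapsto r(\eta(x),\eta(y))$, with $\eta$ a non-constant germ of a holomorphic map $\mathbb{C}\to\mathbb{C}$ (the base point may be moved, e.g. $\eta(u)=\exp(u/m)$ at $u=0$). A one-variable function $\varrho$ is identified with the two-variable function $\varrho(u-v)$. The classical Yang–Baxter equation with one spectral parameter, for a meromorphic germ $\varrho:(\mathbb{C},0)\to\mathfrak{g}\otimes\mathfrak{g}$, is $[\varrho^{12}(x),\varrho^{13}(x+y)]+[\varrho^{12}(x),\varrho^{23}(y)]+[\varrho^{13}(x+y),\varrho^{23}(y)]=0$. A solution is non-degenerate if for generic $x$ the tensor $\varrho(x)$ defines, via the Killing form, an isomorphism $\mathfrak{g}\to\mathfrak{g}$. Any non-degenerate solution extends meromorphically to $\mathbb{C}$ and its poles form an additive subgroup $\Lambda\subset\mathbb{C}$ of rank $\le2$ (Belavin–Drinfeld); it is called trigonometric if $\mathrm{rk}(\Lambda)=1$. *)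

theory Defs
  imports
    "HOL-Complex_Analysis.Complex_Analysis"
    "HOL-Combinatorics.Orbits"
begin

no_notation fps_nth (infixl "$" 75)

text \<open>
  An \<open>n\<close>-dimensional complex Lie algebra is a bracket on \<open>complex ^ 'n\<close>.  Tensors in
  \<open>g \<otimes> g\<close> and \<open>g \<otimes> g \<otimes> g\<close> are coordinate vectors with respect to the bases of tensor
  products of standard basis vectors.
\<close>

section \<open>Lie algebras\<close>

definition lie_algebra :: "(complex^'n \<Rightarrow> complex^'n \<Rightarrow> complex^'n) \<Rightarrow> bool" where
  "lie_algebra br \<longleftrightarrow>
     (\<forall>a. Vector_Spaces.linear (*s) (*s) (br a)) \<and>
     (\<forall>b. Vector_Spaces.linear (*s) (*s) (\<lambda>a. br a b)) \<and>
     (\<forall>a. br a a = 0) \<and>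
     (\<forall>a b c. br a (br b c) + br b (br c a) + br c (br a b) = 0)"

definition lie_ideal :: "(complex^'n \<Rightarrow> complex^'n \<Rightarrow> complex^'n) \<Rightarrow> (complex^'n) set \<Rightarrow> bool" where
  "lie_ideal br I \<longleftrightarrow> vec.subspace I \<and> (\<forall>a. \<forall>b\<in>I. br a b \<in> I)"

definition simple_lie_algebra :: "(complex^'n \<Rightarrow> complex^'n \<Rightarrow> complex^'n) \<Rightarrow> bool" where
  "simple_lie_algebra br \<longleftrightarrow>
     lie_algebra br \<and> (\<exists>a b. br a b \<noteq> 0) \<and> (\<forall>I. lie_ideal br I \<longrightarrow> I = {0} \<or> I = UNIV)"

definition lie_subalgebra :: "(complex^'n \<Rightarrow> complex^'n \<Rightarrow> complex^'n) \<Rightarrow> (complex^'n) set \<Rightarrow> bool" where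
  "lie_subalgebra br S \<longleftrightarrow> vec.subspace S \<and> (\<forall>a\<in>S. \<forall>b\<in>S. br a b \<in> S)"

definition lie_automorphism ::
    "(complex^'n \<Rightarrow> complex^'n \<Rightarrow> complex^'n) \<Rightarrow> (complex^'n \<Rightarrow> complex^'n) \<Rightarrow> bool" where
  "lie_automorphism br f \<longleftrightarrow>
     Vector_Spaces.linear (*s) (*s) f \<and> bij f \<and> (\<forall>a b. f (br a b) = br (f a) (f b))"

definition killing ::
    "(complex^'n \<Rightarrow> complex^'n \<Rightarrow> complex^'n) \<Rightarrow> complex^'n \<Rightarrow> complex^'n \<Rightarrow> complex" where
  "killing br a b = trace (matrix (br a) ** matrix (br b))"

definition has_order :: "('a \<Rightarrow> 'a) \<Rightarrow> nat \<Rightarrow> bool" where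
  "has_order f m \<longleftrightarrow> 0 < m \<and> f ^^ m = id \<and> (\<forall>k. 0 < k \<and> k < m \<longrightarrow> f ^^ k \<noteq> id)"

definition grading_part :: "(complex^'n \<Rightarrow> complex^'n) \<Rightarrow> nat \<Rightarrow> int \<Rightarrow> (complex^'n) set" where
  "grading_part \<sigma> m j = {a. \<sigma> a = exp (2 * pi * \<i> * of_int j / of_nat m) *s a}"


section \<open>Tensors\<close>

type_synonym 'n tensor2 = "complex ^ ('n \<times> 'n)"
type_synonym 'n tensor3 = "complex ^ ('n \<times> 'n \<times> 'n)"

definition tens2 :: "complex^'n \<Rightarrow> complex^'n \<Rightarrow> 'n tensor2" where
  "tens2 a b = vec_lambda (\<lambda>(i, j). a $ i * b $ j)"

definition tens3 :: "complex^'n \<Rightarrow> complex^'n \<Rightarrow> complex^'n \<Rightarrow> 'n tensor3" where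
  "tens3 a b c = vec_lambda (\<lambda>(i, j, k). a $ i * b $ j * c $ k)"

definition tensor_subspace :: "(complex^'n) set \<Rightarrow> (complex^'n) set \<Rightarrow> ('n tensor2) set" where
  "tensor_subspace A B = vec.span {tens2 a b | a b. a \<in> A \<and> b \<in> B}"

definition tens2_map ::
    "(complex^'n \<Rightarrow> complex^'n) \<Rightarrow> (complex^'n \<Rightarrow> complex^'n) \<Rightarrow> 'n tensor2 \<Rightarrow> 'n tensor2" where
  "tens2_map f g T = (\<Sum>i\<in>UNIV. \<Sum>j\<in>UNIV. T $ (i, j) *s tens2 (f (axis i 1)) (g (axis j 1)))"

definition tens2_flip :: "'n::finite tensor2 \<Rightarrow> 'n tensor2" where
  "tens2_flip T = vec_lambda (\<lambda>(i, j). T $ (j, i))"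

text \<open>The brackets \<open>[r\<^sup>1\<^sup>2, s\<^sup>1\<^sup>3]\<close>, \<open>[r\<^sup>1\<^sup>2, s\<^sup>2\<^sup>3]\<close> and \<open>[r\<^sup>1\<^sup>3, s\<^sup>2\<^sup>3]\<close>.\<close>

definition br_12_13 ::
    "(complex^'n \<Rightarrow> complex^'n \<Rightarrow> complex^'n) \<Rightarrow> 'n tensor2 \<Rightarrow> 'n tensor2 \<Rightarrow> 'n tensor3" where
  "br_12_13 br r s = (\<Sum>i\<in>UNIV. \<Sum>j\<in>UNIV. \<Sum>k\<in>UNIV. \<Sum>l\<in>UNIV. (r $ (i, j) * s $ (k, l)) *s
     tens3 (br (axis i 1) (axis k 1)) (axis j 1) (axis l 1))"

definition br_12_23 ::
    "(complex^'n \<Rightarrow> complex^'n \<Rightarrow> complex^'n) \<Rightarrow> 'n tensor2 \<Rightarrow> 'n tensor2 \<Rightarrow> 'n tensor3" where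
  "br_12_23 br r s = (\<Sum>i\<in>UNIV. \<Sum>j\<in>UNIV. \<Sum>k\<in>UNIV. \<Sum>l\<in>UNIV. (r $ (i, j) * s $ (k, l)) *s
     tens3 (axis i 1) (br (axis j 1) (axis k 1)) (axis l 1))"

definition br_13_23 ::
    "(complex^'n \<Rightarrow> complex^'n \<Rightarrow> complex^'n) \<Rightarrow> 'n tensor2 \<Rightarrow> 'n tensor2 \<Rightarrow> 'n tensor3" where
  "br_13_23 br r s = (\<Sum>i\<in>UNIV. \<Sum>j\<in>UNIV. \<Sum>k\<in>UNIV. \<Sum>l\<in>UNIV. (r $ (i, j) * s $ (k, l)) *s
     tens3 (axis i 1) (axis k 1) (br (axis j 1) (axis l 1)))"

text \<open>
  The Casimir element: the sum of \<open>e\<^sub>i \<otimes> e\<^sub>i'\<close> over a basis and its dual basis with respect to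
  the Killing form (independent of the basis; here the standard one).
\<close>

definition killing_dual ::
    "(complex^'n \<Rightarrow> complex^'n \<Rightarrow> complex^'n) \<Rightarrow> 'n \<Rightarrow> complex^'n" where
  "killing_dual br i = (THE v. \<forall>j. killing br v (axis j 1) = (if j = i then 1 else 0))"

definition casimir :: "(complex^'n \<Rightarrow> complex^'n \<Rightarrow> complex^'n) \<Rightarrow> 'n tensor2" where
  "casimir br = (\<Sum>i\<in>UNIV. tens2 (axis i 1) (killing_dual br i))"

text \<open>The linear map defined by a tensor: \<open>a \<otimes> b\<close> is sent to \<open>x \<mapsto> \<kappa>(b, x) a\<close>.\<close>

definition killing_map ::
    "(complex^'n \<Rightarrow> complex^'n \<Rightarrow> complex^'n) \<Rightarrow> 'n tensor2 \<Rightarrow> complex^'n \<Rightarrow> complex^'n" where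
  "killing_map br T x =
     (\<Sum>i\<in>UNIV. \<Sum>j\<in>UNIV. (T $ (i, j) * killing br (axis j 1) x) *s axis i 1)"


section \<open>Coxeter automorphisms\<close>

definition cartan_matrix :: "nat \<Rightarrow> (nat \<Rightarrow> nat \<Rightarrow> int) \<Rightarrow> bool" where
  "cartan_matrix N A \<longleftrightarrow>
     (\<forall>i<N. A i i = 2) \<and>
     (\<forall>i<N. \<forall>j<N. i \<noteq> j \<longrightarrow> A i j \<le> 0 \<and> (A i j = 0 \<longrightarrow> A j i = 0))"

text \<open>
  For a simple (finite-dimensional) Lie algebra the conditions below force \<open>A\<close> to be its Cartan
  matrix, the span of the \<open>h i\<close> to be a Cartan subalgebra and the \<open>e i\<close> to be root vectors for
  the simple roots; the Serre relations then hold automatically.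
\<close>

definition chevalley_generators ::
    "(complex^'n \<Rightarrow> complex^'n \<Rightarrow> complex^'n) \<Rightarrow> nat \<Rightarrow> (nat \<Rightarrow> nat \<Rightarrow> int) \<Rightarrow>
     (nat \<Rightarrow> complex^'n) \<Rightarrow> (nat \<Rightarrow> complex^'n) \<Rightarrow> (nat \<Rightarrow> complex^'n) \<Rightarrow> bool" where
  "chevalley_generators br N A e f h \<longleftrightarrow>
     cartan_matrix N A \<and>
     inj_on h {..<N} \<and> \<not> vec.dependent (h ` {..<N}) \<and>
     (\<forall>i<N. \<forall>j<N. br (h i) (h j) = 0 \<and>
        br (e i) (f j) = (if i = j then h i else 0) \<and>
        br (h i) (e j) = of_int (A i j) *s e j \<and>
        br (h i) (f j) = - of_int (A i j) *s f j) \<and>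
     lie_subalgebra br hull (e ` {..<N} \<union> f ` {..<N}) = UNIV"

definition dynkin_automorphism :: "nat \<Rightarrow> (nat \<Rightarrow> nat \<Rightarrow> int) \<Rightarrow> (nat \<Rightarrow> nat) \<Rightarrow> bool" where
  "dynkin_automorphism N A \<phi> \<longleftrightarrow>
     \<phi> permutes {..<N} \<and> (\<forall>i<N. \<forall>j<N. A (\<phi> i) (\<phi> j) = A i j)"

text \<open>
  Kac's finite-order automorphism \<open>\<sigma>\<close> of type \<open>(s; r)\<close>, attached to the automorphism \<open>\<phi>\<close> (of order
  \<open>r\<close>) of the Dynkin diagram.  The diagram automorphism of the Lie algebra is \<open>\<mu>\<close>, the simple
  root vectors of its fixed subalgebra are, up to scalars, the orbit sums \<open>E O\<close>, and \<open>E0\<close> is a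
  lowest weight vector of the \<open>exp(2\<pi>i/r)\<close>-eigenspace of \<open>\<mu>\<close>, as a module over the fixed
  subalgebra.  The marks \<open>a O\<close> are the coefficients of minus the weight of \<open>E0\<close> in terms of the
  simple roots, the mark of the additional node being \<open>1\<close>; the weight \<open>s0\<close> is attached to that
  node and \<open>s O\<close> to the node given by the orbit \<open>O\<close>.  In the weight condition, \<open>t\<close> runs through
  the fixed part of the Cartan subalgebra and \<open>c O\<close> is the value at \<open>t\<close> of the simple root of
  \<open>E O\<close>.
\<close>

definition kac_type ::
    "(complex^'n \<Rightarrow> complex^'n \<Rightarrow> complex^'n) \<Rightarrow> nat \<Rightarrow> (nat \<Rightarrow> complex^'n) \<Rightarrow>
     (nat \<Rightarrow> complex^'n) \<Rightarrow> (nat \<Rightarrow> complex^'n) \<Rightarrow> (nat \<Rightarrow> nat) \<Rightarrow>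
     nat \<Rightarrow> (nat set \<Rightarrow> nat) \<Rightarrow> nat \<Rightarrow> (complex^'n \<Rightarrow> complex^'n) \<Rightarrow> bool" where
  "kac_type br N e f h \<phi> s0 s r \<sigma> \<longleftrightarrow>
     (let Orb = orbit \<phi> ` {..<N};
          E = (\<lambda>O'. \<Sum>i\<in>O'. e i);
          F = (\<lambda>O'. \<Sum>i\<in>O'. f i)
      in has_order \<phi> r \<and> Gcd (insert s0 (s ` Orb)) = 1 \<and> lie_automorphism br \<sigma> \<and>
         (\<exists>\<mu> E0 a m.
            lie_automorphism br \<mu> \<and> (\<forall>i<N. \<mu> (e i) = e (\<phi> i) \<and> \<mu> (f i) = f (\<phi> i)) \<and>
            E0 \<noteq> 0 \<and> E0 \<in> grading_part \<mu> r 1 \<and> (\<forall>O'\<in>Orb. br (F O') E0 = 0) \<and>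
            (\<forall>t c. t \<in> vec.span (h ` {..<N}) \<and> \<mu> t = t \<and> (\<forall>O'\<in>Orb. br t (E O') = c O' *s E O') \<longrightarrow>
               br t E0 = (- (\<Sum>O'\<in>Orb. of_nat (a O') * c O')) *s E0) \<and>
            m = r * (s0 + (\<Sum>O'\<in>Orb. a O' * s O')) \<and>
            \<sigma> E0 = exp (2 * pi * \<i> * of_nat s0 / of_nat m) *s E0 \<and>
            (\<forall>O'\<in>Orb. \<sigma> (E O') = exp (2 * pi * \<i> * of_nat (s O') / of_nat m) *s E O')))"

definition coxeter_automorphism ::
    "(complex^'n \<Rightarrow> complex^'n \<Rightarrow> complex^'n) \<Rightarrow> (complex^'n \<Rightarrow> complex^'n) \<Rightarrow> bool" where
  "coxeter_automorphism br \<sigma> \<longleftrightarrow>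
     (\<exists>N A e f h \<phi> r.
        chevalley_generators br N A e f h \<and> dynkin_automorphism N A \<phi> \<and>
        kac_type br N e f h \<phi> 1 (\<lambda>_. 1) r \<sigma>)"


section \<open>Meromorphic germs in two variables\<close>

text \<open>
  Holomorphy in two variables: the total derivative exists and is complex linear.
\<close>

definition holomorphic2_on :: "(complex \<times> complex \<Rightarrow> complex) \<Rightarrow> (complex \<times> complex) set \<Rightarrow> bool" where
  "holomorphic2_on f S \<longleftrightarrow>
     (\<forall>z\<in>S. \<exists>a b. (f has_derivative (\<lambda>h. a * fst h + b * snd h)) (at z))"

definition tensor_holomorphic2_on ::
    "(complex \<times> complex \<Rightarrow> 'n::finite tensor2) \<Rightarrow> (complex \<times> complex) set \<Rightarrow> bool" where
  "tensor_holomorphic2_on f S \<longleftrightarrow> (\<forall>p. holomorphic2_on (\<lambda>z. f z $ p) S)"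

text \<open>
  Functions are total, so a meromorphic function has meaningless values on a hypersurface.
  Identities of meromorphic germs at \<open>z\<close> are required off the zero set of some holomorphic function
  \<open>q\<close> that does not vanish identically on any open set.
\<close>

definition generically_near ::
    "complex \<times> complex \<Rightarrow> (complex \<times> complex \<Rightarrow> bool) \<Rightarrow> bool" where
  "generically_near z P \<longleftrightarrow>
     (\<exists>V q. open V \<and> z \<in> V \<and> holomorphic2_on q V \<and> V \<subseteq> closure {w \<in> V. q w \<noteq> 0} \<and>
        (\<forall>w\<in>V. q w \<noteq> 0 \<longrightarrow> P w))"

definition meromorphic2_at :: "(complex \<times> complex \<Rightarrow> 'n::finite tensor2) \<Rightarrow> complex \<times> complex \<Rightarrow> bool" where
  "meromorphic2_at r z \<longleftrightarrow>
     (\<exists>V p q. open V \<and> z \<in> V \<and> tensor_holomorphic2_on p V \<and> holomorphic2_on q V \<and>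
        V \<subseteq> closure {w \<in> V. q w \<noteq> 0} \<and> (\<forall>w\<in>V. q w \<noteq> 0 \<longrightarrow> r w = (1 / q w) *s p w))"


section \<open>Equivalence\<close>

text \<open>
  A pair \<open>(r, a)\<close> stands for the germ of \<open>r\<close> at the point \<open>(a, a)\<close> of the diagonal.  A change of
  variables \<open>\<eta>\<close> at \<open>b\<close> may move the base point: \<open>\<eta> b\<close> can be any point that is joined to \<open>a\<close>
  inside a connected open set \<open>W\<close> for which \<open>r\<close> is meromorphic on \<open>W \<times> W\<close>.  Both rules allow
  \<open>s\<close> to be an arbitrary representative of the resulting germ.
\<close>

inductive equiv_step ::
    "(complex^'n \<Rightarrow> complex^'n \<Rightarrow> complex^'n) \<Rightarrow>
     (complex \<times> complex \<Rightarrow> 'n tensor2) \<times> complex \<Rightarrow>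
     (complex \<times> complex \<Rightarrow> 'n tensor2) \<times> complex \<Rightarrow> bool"
  for br where
  gauge: "equiv_step br (r, a) (s, a)"
    if "meromorphic2_at r (a, a)"
      and "open U" and "a \<in> U"
      and "\<forall>z\<in>U. lie_automorphism br (\<phi> z)"
      and "\<forall>v i. (\<lambda>z. \<phi> z v $ i) holomorphic_on U"
      and "generically_near (a, a) (\<lambda>(x, y). s (x, y) = tens2_map (\<phi> x) (\<phi> y) (r (x, y)))"
| change_of_variables: "equiv_step br (r, a) (s, b)"
    if "open W" and "connected W" and "a \<in> W" and "\<eta> b \<in> W"
      and "\<forall>z\<in>W \<times> W. meromorphic2_at r z"
      and "\<eta> analytic_on {b}"
      and "\<not> (\<forall>\<^sub>F u in nhds b. \<eta> u = \<eta> b)"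
      and "generically_near (b, b) (\<lambda>(u, v). s (u, v) = r (\<eta> u, \<eta> v))"

abbreviation solution_equiv ::
    "(complex^'n \<Rightarrow> complex^'n \<Rightarrow> complex^'n) \<Rightarrow>
     (complex \<times> complex \<Rightarrow> 'n tensor2) \<times> complex \<Rightarrow>
     (complex \<times> complex \<Rightarrow> 'n tensor2) \<times> complex \<Rightarrow> bool" where
  "solution_equiv br \<equiv> equivclp (equiv_step br)"


section \<open>The classical Yang-Baxter equation\<close>

definition cybe_two_variables ::
    "(complex^'n \<Rightarrow> complex^'n \<Rightarrow> complex^'n) \<Rightarrow> (complex \<times> complex) set \<Rightarrow>
     (complex \<times> complex \<Rightarrow> 'n tensor2) \<Rightarrow> bool" where
  "cybe_two_variables br D r \<longleftrightarrow>
     (\<forall>x1 x2 x3. (x1, x2) \<in> D \<and> (x1, x3) \<in> D \<and> (x2, x3) \<in> D \<longrightarrow>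
        br_12_13 br (r (x1, x2)) (r (x1, x3)) + br_13_23 br (r (x1, x3)) (r (x2, x3)) +
        br_12_23 br (r (x1, x2)) (r (x2, x3)) = 0) \<and>
     (\<forall>x1 x2. (x1, x2) \<in> D \<longrightarrow> r (x1, x2) = - tens2_flip (r (x2, x1)))"

definition tensor_meromorphic_on :: "(complex \<Rightarrow> 'n::finite tensor2) \<Rightarrow> complex set \<Rightarrow> bool" where
  "tensor_meromorphic_on \<rho> S \<longleftrightarrow> (\<forall>p. (\<lambda>x. \<rho> x $ p) meromorphic_on S)"

text \<open>
  A meromorphic germ at \<open>0\<close> has no other pole close to \<open>0\<close>, so the equation makes sense whenever
  \<open>x\<close>, \<open>y\<close> and \<open>x + y\<close> are small and non-zero.
\<close>

definition cybe_one_parameter ::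
    "(complex^'n \<Rightarrow> complex^'n \<Rightarrow> complex^'n) \<Rightarrow> (complex \<Rightarrow> 'n tensor2) \<Rightarrow> bool" where
  "cybe_one_parameter br \<rho> \<longleftrightarrow>
     tensor_meromorphic_on \<rho> {0} \<and>
     (\<exists>\<epsilon>>0. \<forall>x y. x \<in> ball 0 \<epsilon> - {0} \<and> y \<in> ball 0 \<epsilon> - {0} \<and> x + y \<in> ball 0 \<epsilon> - {0} \<longrightarrow>
        br_12_13 br (\<rho> x) (\<rho> (x + y)) + br_12_23 br (\<rho> x) (\<rho> y) +
        br_13_23 br (\<rho> (x + y)) (\<rho> y) = 0)"

definition nondegenerate ::
    "(complex^'n \<Rightarrow> complex^'n \<Rightarrow> complex^'n) \<Rightarrow> (complex \<Rightarrow> 'n tensor2) \<Rightarrow> bool" where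
  "nondegenerate br \<rho> \<longleftrightarrow> (\<forall>\<^sub>F x in at 0. bij (killing_map br (\<rho> x)))"

definition tensor_poles :: "(complex \<Rightarrow> 'n::finite tensor2) \<Rightarrow> complex set" where
  "tensor_poles \<rho> = {z. \<exists>p. is_pole (\<lambda>x. \<rho> x $ p) z}"

text \<open>\<open>\<Lambda>\<close> is a free abelian subgroup of the complex numbers with a basis of \<open>k\<close> elements.\<close>

definition subgroup_of_rank :: "complex set \<Rightarrow> nat \<Rightarrow> bool" where
  "subgroup_of_rank \<Lambda> k \<longleftrightarrow>
     (\<exists>B. finite B \<and> card B = k \<and>
        (\<forall>c :: complex \<Rightarrow> int. (\<Sum>b\<in>B. of_int (c b) * b) = 0 \<longrightarrow> (\<forall>b\<in>B. c b = 0)) \<and>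
        \<Lambda> = range (\<lambda>c :: complex \<Rightarrow> int. \<Sum>b\<in>B. of_int (c b) * b))"

definition trigonometric_solution ::
    "(complex^'n \<Rightarrow> complex^'n \<Rightarrow> complex^'n) \<Rightarrow> (complex \<Rightarrow> 'n tensor2) \<Rightarrow> bool" where
  "trigonometric_solution br \<rho> \<longleftrightarrow>
     cybe_one_parameter br \<rho> \<and> nondegenerate br \<rho> \<and>
     (\<exists>R. tensor_meromorphic_on R UNIV \<and> (\<forall>\<^sub>F x in at 0. R x = \<rho> x) \<and>
        subgroup_of_rank (tensor_poles R) 1)"

end

theory Submission
  imports Defs
begin

text \<open>
  After \<open>x = exp (u / m)\<close>, \<open>y = exp (v / m)\<close> the solution becomes \<open>R (u, v) = \<psi> (u - v) + G (u, v)\<close>,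
  with \<open>G\<close> entire and \<open>\<psi> z = casimir / z + O(1)\<close>.  Bracketing the first two tensor factors of the
  Yang-Baxter equation at \<open>(u, t, w)\<close>, where the Casimir element acts as the identity, and letting
  \<open>t\<close> tend to \<open>u\<close> gives \<open>\<partial>\<^sub>u R = [f u \<otimes> 1, R] + R \<star> R\<close> with an entire function \<open>f\<close> and
  \<open>(a \<otimes> b) \<star> (c \<otimes> d) = [a, c] \<otimes> [b, d]\<close>.  In \<open>\<partial>\<^sub>u R + \<partial>\<^sub>v R\<close> the quadratic terms cancel by
  skew-symmetry, so an entire solution of \<open>\<Phi>' = - \<Phi> \<circ> ad f\<close>, which takes values in the
  automorphism group, gauges \<open>R\<close> to a function \<open>\<rho> (u - v)\<close>.  As \<open>\<Phi>\<close> is entire, \<open>\<rho>\<close> is meromorphic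
  on the whole plane, and its residue at \<open>2 \<pi> \<i> k\<close> is the image of the Casimir element under the
  bijection \<open>\<Phi> (2 \<pi> \<i> k) \<sigma>\<^sup>k \<otimes> 1\<close>; hence its poles are exactly the elements of \<open>2 \<pi> \<i> \<int>\<close>.
\<close>

section \<open>Nondegeneracy of the Killing form\<close>

text \<open>It is the pole of \<open>R (u, t)\<close> that turns an algebraic identity into a
  differential one. After the contraction, \<open>casimir / (u - t)\<close> occurs in two terms,
  acting by \<open>-1\<close> in one and by \<open>+1\<close> in the other; together they leave, up
  to sign, the difference quotient \<open>(R (u, w) - R (t, w)) / (u - t)\<close>, and all other
  terms have a limit. The function \<open>f\<close> is obtained by bracketing the two legs of the
  regular part of \<open>R\<close> on the diagonal; by the Jacobi identity the two linear terms
  combine to \<open>ad f\<close>, a derivation, and this is why the gauge consists of automorphisms.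
  The exponential substitution is suggested by the explicit part of \<open>r\<close>, which depends
  on \<open>x / y\<close> alone. Two obstacles shape the rest. Being trigonometric concerns poles in
  the whole plane and not just a germ at \<open>0\<close>, so the equation for \<open>\<Phi>\<close>
  has to be solved globally. And \<open>casimir\<close> is built from vectors given by a definite
  description, about which nothing is known until the Killing form is nondegenerate; simplicity
  reduces this to finding one nonzero value of the form.\<close>

abbreviation clinear :: "(complex^'a \<Rightarrow> complex^'b) \<Rightarrow> bool" where
  "clinear \<equiv> Vector_Spaces.linear (*s) (*s)"

text \<open>Extend \<open>v\<close> to a basis of eigenvectors: the trace of the square becomes a
  sum of squares of integers, and \<open>k0\<close> is among them.\<close>

lemma trace_square_integral_spectrum:
  fixes f :: "complex^'n \<Rightarrow> complex^'n"
  assumes lin: "clinear f"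
    and span: "vec.span {v. \<exists>k::int. f v = of_int k *s v} = UNIV"
    and v: "f v = of_int k0 *s v" "v \<noteq> 0" "k0 \<noteq> 0"
  shows "trace (matrix f ** matrix f) \<noteq> 0"
proof -
  let ?S = "{v. \<exists>k::int. f v = of_int k *s v}"
  have vS: "{v} \<subseteq> ?S" using v by auto
  have "vec.independent {v}" using v(2) by simp
  then obtain B where B: "{v} \<subseteq> B" "B \<subseteq> ?S" "vec.independent B" "?S \<subseteq> vec.span B"
    using vec.maximal_independent_subset_extend[OF vS] by blast
  have spB: "vec.span B = UNIV"
    using vec.span_minimal[OF B(4)] span vec.subspace_span by blast
  have finB: "finite B" using B(3) vec.finiteI_independent by blast
  have "card B = CARD('n)"
    using vec.basis_card_eq_dim[of B UNIV] B(3) spB vec_dim_card[where ?'n='n and ?'a=complex] by simp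
  then obtain b where b: "bij_betw b (UNIV::'n set) B"
    using finite_same_card_bij[of "UNIV::'n set" B] finB by auto
  \<comment> \<open>The columns of \<open>P\<close> are the eigenvectors, so \<open>P\<close>
    conjugates \<open>matrix f\<close> to the diagonal matrix \<open>D\<close>.\<close>
  define P :: "complex^'n^'n" where "P = (\<chi> i j. b j $ i)"
  have colP: "column j P = b j" for j by (simp add: P_def column_def vec_eq_iff)
  have "columns P = B"
    using b by (auto simp: columns_def colP bij_betw_def)
  then have "vec.span (columns P) = UNIV" using spB by simp
  then obtain Q where Q: "P ** Q = mat 1"
    using matrix_right_invertible_span_columns by blast
  then have Q': "Q ** P = mat 1" using matrix_left_right_inverse by blast
  have "\<forall>j. \<exists>k::int. f (b j) = of_int k *s b j"
    using b B(2) by (auto simp: bij_betw_def)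
  then obtain k :: "'n \<Rightarrow> int" where k: "\<And>j. f (b j) = of_int (k j) *s b j" by metis
  define D :: "complex^'n^'n" where "D = (\<chi> i j. if i = j then of_int (k j) else 0)"
  let ?M = "matrix f"
  have MP: "?M ** P = P ** D"
  proof -
    have "(?M ** P) $ i $ j = (P ** D) $ i $ j" for i j
    proof -
      have "(?M ** P) $ i $ j = (?M *v column j P) $ i"
        by (simp add: matrix_matrix_mult_def matrix_vector_mult_def column_def)
      also have "\<dots> = of_int (k j) * b j $ i" 
        by (simp add: colP matrix_works[OF lin] k)
      also have "\<dots> = (P ** D) $ i $ j"
        by (simp add: matrix_matrix_mult_def P_def D_def if_distrib[of "\<lambda>x. _ * x"] cong: if_cong)
      finally show ?thesis .
    qed
    then show ?thesis by (simp add: vec_eq_iff)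
  qed
  have M: "?M = P ** D ** Q"
  proof -
    have "?M = ?M ** (P ** Q)" by (simp add: Q)
    also have "\<dots> = (?M ** P) ** Q" by (simp only: matrix_mul_assoc)
    finally show ?thesis by (simp only: MP)
  qed
  have "?M ** ?M = (?M ** P) ** (D ** Q)"
    by (subst (2) M) (simp only: matrix_mul_assoc)
  also have "\<dots> = P ** (D ** D ** Q)" by (simp only: MP matrix_mul_assoc)
  finally have "?M ** ?M = P ** (D ** D ** Q)" .
  then have "trace (?M ** ?M) = trace ((D ** D ** Q) ** P)"
    using trace_mul_sym[of P "D ** D ** Q"] by simp
  also have "(D ** D ** Q) ** P = (D ** D) ** (Q ** P)" by (simp only: matrix_mul_assoc)
  also have "\<dots> = D ** D" by (simp add: Q')
  also have "trace (D ** D) = of_int (\<Sum>i\<in>UNIV. (k i)\<^sup>2)"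
    by (simp add: trace_def matrix_matrix_mult_def D_def if_distrib[of "\<lambda>x. _ * x"] power2_eq_square cong: if_cong)
  also have "\<dots> \<noteq> 0"
  proof -
    obtain j where j: "b j = v" using b B(1) by (auto simp: bij_betw_def)
    then have "of_int (k j) *s v = of_int k0 *s v" using k[of j] v by simp
    then have "k j = k0" using v(2) by (simp add: vec.scale_right_imp_eq)
    then have "(\<Sum>i\<in>UNIV. (k i)\<^sup>2) > 0"
      using v(3) by (intro sum_pos2[of _ j]) auto
    then show ?thesis unfolding of_int_eq_0_iff by simp
  qed
  finally show ?thesis .
qed

section \<open>Lie algebra identities and invariance of the Killing form\<close>

locale complex_lie =
  fixes br :: "complex^'n \<Rightarrow> complex^'n \<Rightarrow> complex^'n"
  assumes lie: "lie_algebra br"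
begin

lemma lin_right: "clinear (br a)" and lin_left: "clinear (\<lambda>a. br a b)"
  using lie by (auto simp: lie_algebra_def)

lemmas br_add_right = vec.linear_add[OF lin_right]
  and br_add_left = vec.linear_add[OF lin_left]
  and br_scale_right = vec.linear_scale[OF lin_right]
  and br_scale_left = vec.linear_scale[OF lin_left]
  and br_sum_left = vec.linear_sum[OF lin_left]
  and br_neg_right = vec.linear_neg[OF lin_right]
  and br_zero_right = vec.linear_0[OF lin_right]
  and br_zero_left = vec.linear_0[OF lin_left]

lemma br_self: "br a a = 0"
  using lie by (auto simp: lie_algebra_def)

lemma br_antisym: "br a b = - br b a"
proof -
  have "br (a + b) (a + b) = br a b + br b a"
    unfolding br_add_left br_add_right by (simp add: br_self)
  then have "br a b + br b a = 0" by (simp add: br_self)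
  then show ?thesis by (simp add: eq_neg_iff_add_eq_0)
qed

lemma jacobi: "br a (br b c) = br (br a b) c + br b (br a c)"
proof -
  have "br a (br b c) + br b (br c a) + br c (br a b) = 0"
    using lie by (auto simp: lie_algebra_def)
  moreover have "br b (br c a) = - br b (br a c)"
    by (subst br_antisym[of c a]) (simp add: br_neg_right)
  moreover have "br c (br a b) = - br (br a b) c" by (rule br_antisym)
  ultimately show ?thesis by (simp add: algebra_simps)
qed

lemma ad_works: "matrix (br a) *v x = br a x"
  by (rule matrix_works[OF lin_right])

lemma ad_bracket: "matrix (br (br a b)) = matrix (br a) ** matrix (br b) - matrix (br b) ** matrix (br a)"
  unfolding matrix_eq
  by (simp add: matrix_vector_mult_diff_rdistrib matrix_vector_mul_assoc[symmetric] ad_works jacobi[of a b])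

lemma killing_sym: "killing br a b = killing br b a"
  unfolding killing_def by (rule trace_mul_sym)

lemma killing_linear: "Vector_Spaces.linear (*s) (*) (killing br a)"
proof -
  have add: "matrix (br (x + y)) = matrix (br x) + matrix (br y)" for x y
    by (simp add: matrix_def vec_eq_iff br_add_left)
  have scale: "matrix (br (c *s x)) = (\<chi> i j. c * matrix (br x) $ i $ j)" for c x
    by (simp add: matrix_def vec_eq_iff br_scale_left)
  have "killing br a (x + y) = killing br a x + killing br a y" for x y
    by (simp add: killing_def add matrix_add_ldistrib trace_add)
  moreover have "killing br a (c *s x) = c * killing br a x" for c x
    by (simp add: killing_def scale trace_def matrix_matrix_mult_def sum_distrib_left algebra_simps)
  ultimately show ?thesis
    by (intro Vector_Spaces.linear.intro module_hom.intro)
      (auto intro!: module_hom_axioms.intro vec.vector_space_axioms 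
        simp: vec.module_axioms vector_space_def module_def algebra_simps)
qed

lemma killing_add: "killing br a (x + y) = killing br a x + killing br a y"
  using killing_linear[of a] by (simp add: Vector_Spaces.linear_iff)

lemma killing_scale: "killing br a (c *s x) = c * killing br a x"
  using killing_linear[of a] by (simp add: Vector_Spaces.linear_iff)

lemma killing_sum: "killing br a (\<Sum>i\<in>I. x i) = (\<Sum>i\<in>I. killing br a (x i))"
proof -
  have "killing br a 0 = 0" using killing_scale[of a 0 0] by simp
  then show ?thesis by (induction I rule: infinite_finite_induct) (auto simp: killing_add)
qed

lemma killing_minus: "killing br a (- x) = - killing br a x"
  using killing_scale[of a "-1" x] by simp

text \<open>With \<open>ad\<close> of a bracket written as a commutator, the two sides differ by a
  cyclic permutation inside a trace.\<close>

lemma killing_invariant: "killing br (br a b) c = killing br a (br b c)"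
proof -
  have diff_left: "(A - B) ** C = A ** C - B ** C" and diff_right: "C ** (A - B) = C ** A - C ** B"
    for A B C :: "complex^'n^'n"
    by (simp_all add: matrix_matrix_mult_def vec_eq_iff algebra_simps sum_subtractf)
  have "trace (matrix (br b) ** matrix (br a) ** matrix (br c)) =
      trace (matrix (br b) ** (matrix (br a) ** matrix (br c)))"
    by (simp only: matrix_mul_assoc)
  also have "\<dots> = trace (matrix (br a) ** matrix (br c) ** matrix (br b))"
    by (rule trace_mul_sym)
  finally have "trace (matrix (br b) ** matrix (br a) ** matrix (br c)) =
      trace (matrix (br a) ** matrix (br c) ** matrix (br b))" .
  then show ?thesis
    unfolding killing_def ad_bracket
    by (simp add: diff_left diff_right trace_sub matrix_mul_assoc)
qed

end

text \<open>
  No Cartan criterion is needed: \<open>ad (h 0)\<close> is diagonalizable with integer eigenvalues, one of which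
  is \<open>2\<close>, so the trace of its square is positive.
\<close>

lemma killing_nonzero:
  assumes simple: "simple_lie_algebra br" and chev: "chevalley_generators br N A e f h"
  shows "\<exists>a b. killing br a b \<noteq> 0"
proof -
  interpret complex_lie br
    using simple by unfold_locales (simp add: simple_lie_algebra_def)
  have hull: "lie_subalgebra br hull (e ` {..<N} \<union> f ` {..<N}) = UNIV"
    using chev by (simp add: chevalley_generators_def)
  \<comment> \<open>For \<open>N = 0\<close> the generated subalgebra would be zero, but a simple
    Lie algebra has a nonzero bracket.\<close>
  have N: "0 < N"
  proof (rule ccontr)
    assume "\<not> 0 < N"
    then have "lie_subalgebra br hull {} = UNIV" using hull by simp
    moreover have "lie_subalgebra br {0}"
      by (simp add: lie_subalgebra_def br_self)
    ultimately have "UNIV \<subseteq> {0 :: complex^'a}"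
      by (metis empty_subsetI hull_minimal)
    then have "br a b = 0" for a b by blast
    then show False using simple by (auto simp: simple_lie_algebra_def)
  qed
  let ?S = "{v. \<exists>k::int. br (h 0) v = of_int k *s v}"
  have rel: "br (h 0) (e j) = of_int (A 0 j) *s e j" "br (h 0) (f j) = of_int (- A 0 j) *s f j" if "j < N" for j
    using chev N that by (auto simp: chevalley_generators_def)
  have S_closed: "br a b \<in> ?S" if a: "a \<in> ?S" and b: "b \<in> ?S" for a b
  proof -
    obtain k l where "br (h 0) a = of_int k *s a" "br (h 0) b = of_int l *s b" using a b by auto
    then have "br (h 0) (br a b) = of_int (k + l) *s br a b"
      by (simp add: jacobi[of "h 0" a b] br_scale_left br_scale_right vec.scale_left_distrib)
    then show ?thesis by blast
  qed
  \<comment> \<open>Eigenvalues of a derivation add under the bracket, so the eigenvectors with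
    integer eigenvalues span a subalgebra; it contains the Chevalley generators and is therefore
    everything.\<close>
  have "lie_subalgebra br (vec.span ?S)"
    unfolding lie_subalgebra_def
  proof (intro conjI ballI vec.subspace_span)
    fix a b assume a: "a \<in> vec.span ?S" and b: "b \<in> vec.span ?S"
    have *: "br x b \<in> vec.span ?S" if "x \<in> ?S" for x
      using b
    proof (induction rule: vec.span_induct_alt)
      case base then show ?case by (simp add: br_zero_right vec.span_zero)
    next
      case (step c y z)
      then show ?case
        using S_closed[OF that, of y]
        by (simp add: br_add_right br_scale_right vec.span_add vec.span_scale vec.span_base)
    qed
    show "br a b \<in> vec.span ?S"
      using a
    proof (induction rule: vec.span_induct_alt)
      case base then show ?case by (simp add: br_zero_left vec.span_zero)
    next
      case (step c y z)
      then show ?case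
        using * by (simp add: br_add_left br_scale_left vec.span_add vec.span_scale)
    qed
  qed
  moreover have "e ` {..<N} \<union> f ` {..<N} \<subseteq> vec.span ?S"
  proof -
    have "e j \<in> ?S" "f j \<in> ?S" if "j < N" for j using rel[OF that] by blast+
    then show ?thesis by (auto intro!: vec.span_base)
  qed
  ultimately have "vec.span ?S = UNIV"
    using hull hull_minimal[of "e ` {..<N} \<union> f ` {..<N}" "vec.span ?S" "lie_subalgebra br"] by blast
  moreover have "br (h 0) (e 0) = of_int 2 *s e 0"
    using rel(1)[OF N] chev N by (simp add: chevalley_generators_def cartan_matrix_def)
  moreover have "e 0 \<noteq> 0"
  proof
    assume "e 0 = 0"
    moreover have "br (e 0) (f 0) = h 0" using chev N by (simp add: chevalley_generators_def)
    ultimately have "h 0 = 0" by (simp add: br_zero_left)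
    moreover have "h 0 \<noteq> 0"
      using chev N vec.dependent_zero[of "h ` {..<N}"] unfolding chevalley_generators_def
      by (metis imageI lessThan_iff)
    ultimately show False by simp
  qed
  ultimately have "trace (matrix (br (h 0)) ** matrix (br (h 0))) \<noteq> 0"
    using trace_square_integral_spectrum[OF lin_right] by fastforce
  then show ?thesis by (auto simp: killing_def)
qed

section \<open>Dual bases and the Casimir element\<close>

locale nondeg_lie = complex_lie +
  assumes nondeg: "\<And>a. (\<And>b. killing br a b = 0) \<Longrightarrow> a = 0"
begin

text \<open>The definite description is meaningful because pairing with the standard basis is an
  injective endomorphism by nondegeneracy, hence bijective.\<close>

lemma killing_dual: "killing br (killing_dual br i) (axis j 1) = (if j = i then 1 else 0)"
proof -
  let ?F = "\<lambda>v. \<chi> j. killing br v (axis j 1)"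
  have lin: "clinear ?F"
    by (simp add: Vector_Spaces.linear_iff vec_eq_iff killing_sym[of _ "axis _ 1"] killing_add killing_scale
        vec.vector_space_axioms)
  have "inj ?F"
    unfolding vec.linear_inj_iff_eq_0[OF lin]
  proof (intro allI impI)
    fix v assume v: "?F v = 0"
    show "v = 0"
    proof (rule nondeg)
      fix b
      have "killing br v b = killing br v (\<Sum>i\<in>UNIV. b $ i *s axis i 1)" by (simp add: basis_expansion)
      also have "\<dots> = 0" using v by (simp add: killing_sum killing_scale vec_eq_iff)
      finally show "killing br v b = 0" .
    qed
  qed
  then have bij: "bij ?F" using vec.linear_inj_imp_surj[OF lin] by (simp add: bij_def)
  then have "\<exists>!v. ?F v = axis i 1" by (simp add: bij_iff)
  then have "\<exists>!v. \<forall>j. killing br v (axis j 1) = (if j = i then 1 else 0)"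
    by (simp add: vec_eq_iff axis_def eq_commute)
  from theI'[OF this] show ?thesis unfolding killing_dual_def by blast
qed

lemma killing_dual_nth: "killing br (killing_dual br i) x = x $ i"
proof -
  have "killing br (killing_dual br i) x = killing br (killing_dual br i) (\<Sum>j\<in>UNIV. x $ j *s axis j 1)"
    by (simp add: basis_expansion)
  also have "\<dots> = x $ i"
    by (simp add: killing_sum killing_scale killing_dual if_distrib[of "\<lambda>x. _ * x"] cong: if_cong)
  finally show ?thesis .
qed

lemma killing_cancel: "(\<And>y. killing br a y = killing br b y) \<Longrightarrow> a = b"
proof -
  assume *: "\<And>y. killing br a y = killing br b y"
  have "killing br y (a + (-1) *s b) = 0" for y
    unfolding killing_add killing_scale using *[of y] by (simp add: killing_sym)
  then have "a + (-1) *s b = 0" using nondeg by (metis killing_sym)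
  then show ?thesis by simp
qed

text \<open>This is the trace of \<open>ad a\<close> composed with \<open>ad b\<close>: pairing with
  \<open>killing_dual br i\<close> reads off the \<open>i\<close>-th coordinate.\<close>

lemma sum_killing_dual:
  "(\<Sum>i\<in>UNIV. killing br (killing_dual br i) (br a (br b (axis i 1)))) = killing br a b"
proof -
  have "killing br a b = (\<Sum>i\<in>UNIV. ((matrix (br a) ** matrix (br b)) *v axis i 1) $ i)"
    by (simp add: killing_def trace_def matrix_vector_mult_def axis_def if_distrib[of "\<lambda>x. _ * x"] cong: if_cong)
  then show ?thesis
    by (simp add: killing_dual_nth matrix_vector_mul_assoc[symmetric] ad_works)
qed

lemma casimir_nth: "casimir br $ (i, j) = killing_dual br i $ j"
  by (simp add: casimir_def tens2_def axis_def if_distrib[of "\<lambda>x. x * _"] cong: if_cong)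

lemma sum_casimir:
  assumes lin: "\<And>a. Vector_Spaces.linear (*s) (*s) (B a)"
  shows "(\<Sum>i\<in>UNIV. \<Sum>j\<in>UNIV. casimir br $ (i, j) *s B (axis i 1) (axis j 1)) =
    (\<Sum>i\<in>UNIV. B (axis i 1) (killing_dual br i))"
proof (rule sum.cong[OF refl])
  fix i
  have "B (axis i 1) (killing_dual br i) = B (axis i 1) (\<Sum>j\<in>UNIV. killing_dual br i $ j *s axis j 1)"
    by (simp add: basis_expansion)
  also have "\<dots> = (\<Sum>j\<in>UNIV. casimir br $ (i, j) *s B (axis i 1) (axis j 1))"
    by (simp add: vec.linear_sum[OF lin] vec.linear_scale[OF lin] casimir_nth)
  finally show "(\<Sum>j\<in>UNIV. casimir br $ (i, j) *s B (axis i 1) (axis j 1)) = B (axis i 1) (killing_dual br i)" ..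
qed

text \<open>The Casimir operator of the adjoint representation is the identity in the normalization
  by the Killing form. Pairing with \<open>y\<close> and moving brackets by invariance gives the
  trace defining \<open>killing br c y\<close>.\<close>

lemma casimir_acts_right:
  "(\<Sum>i\<in>UNIV. \<Sum>j\<in>UNIV. casimir br $ (i, j) *s br (axis i 1) (br (axis j 1) c)) = c"
proof -
  have "clinear (\<lambda>b. br a (br b c))" for a
    using Vector_Spaces.linear_compose[OF lin_left[of c] lin_right[of a]] by (simp add: o_def)
  from sum_casimir[OF this]
  have "(\<Sum>i\<in>UNIV. \<Sum>j\<in>UNIV. casimir br $ (i, j) *s br (axis i 1) (br (axis j 1) c)) =
    (\<Sum>i\<in>UNIV. br (axis i 1) (br (killing_dual br i) c))" .
  also have "\<dots> = c"
  proof (rule killing_cancel)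
    fix y
    have "killing br y (br (axis i 1) (br (killing_dual br i) c)) =
        killing br (killing_dual br i) (br c (br y (axis i 1)))" for i
    proof -
      let ?e = "axis i 1" and ?d = "killing_dual br i"
      have "killing br y (br ?e (br ?d c)) = killing br (br ?d c) (br y ?e)"
        by (metis killing_invariant killing_sym)
      also have "\<dots> = killing br ?d (br c (br y ?e))" by (rule killing_invariant)
      finally show ?thesis .
    qed
    then show "killing br (\<Sum>i\<in>UNIV. br (axis i 1) (br (killing_dual br i) c)) y = killing br c y"
      by (simp add: killing_sym[of _ y] killing_sum sum_killing_dual killing_sym[of c y])
  qed
  finally show ?thesis .
qed

text \<open>The same trace computation, with one bracket reversed. The sign opposite to that of
  \<open>casimir_acts_right\<close> is what later produces a difference of two values of
  \<open>R\<close>.\<close>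

lemma casimir_acts_left:
  "(\<Sum>i\<in>UNIV. \<Sum>j\<in>UNIV. casimir br $ (i, j) *s br (br (axis i 1) c) (axis j 1)) = - c"
proof -
  from sum_casimir[of "\<lambda>a. br (br a c)", OF lin_right]
  have "(\<Sum>i\<in>UNIV. \<Sum>j\<in>UNIV. casimir br $ (i, j) *s br (br (axis i 1) c) (axis j 1)) =
    (\<Sum>i\<in>UNIV. br (br (axis i 1) c) (killing_dual br i))" .
  also have "\<dots> = - c"
  proof (rule killing_cancel)
    fix y
    have "killing br y (br (br (axis i 1) c) (killing_dual br i)) =
        - killing br (killing_dual br i) (br y (br c (axis i 1)))" for i
    proof -
      let ?e = "axis i 1" and ?d = "killing_dual br i"
      have "killing br y (br (br ?e c) ?d) = killing br (br y (br ?e c)) ?d"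
        by (simp add: killing_invariant)
      also have "\<dots> = killing br ?d (br y (- br c ?e))"
        by (simp add: killing_sym br_antisym[of ?e c])
      finally show ?thesis by (simp add: br_neg_right killing_minus)
    qed
    then show "killing br (\<Sum>i\<in>UNIV. br (br (axis i 1) c) (killing_dual br i)) y = killing br (- c) y"
      by (simp add: killing_sym[of _ y] killing_sum sum_killing_dual killing_minus sum_negf)
  qed
  finally show ?thesis .
qed

text \<open>Serves twice: it shows that the Casimir element is nonzero, and that the leading term of
  \<open>\<rho>\<close> at \<open>0\<close> is nondegenerate.\<close>

lemma killing_map_casimir: "killing_map br (casimir br) x = x"
proof -
  have "killing_map br (casimir br) x = (\<Sum>i\<in>UNIV. killing br (killing_dual br i) x *s axis i 1)"
  proof -
    have "killing br (killing_dual br i) x = (\<Sum>j\<in>UNIV. casimir br $ (i, j) * killing br (axis j 1) x)" for i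
    proof -
      have "killing br x (killing_dual br i) = killing br x (\<Sum>j\<in>UNIV. killing_dual br i $ j *s axis j 1)"
        by (simp add: basis_expansion)
      then show ?thesis by (simp add: killing_sum killing_scale casimir_nth killing_sym[of x])
    qed
    then show ?thesis by (simp add: killing_map_def vec.scale_sum_left)
  qed
  then show ?thesis by (simp add: killing_dual_nth basis_expansion)
qed

end

text \<open>By invariance the radical of the Killing form is an ideal; one nonzero value excludes
  that it is everything.\<close>

lemma nondeg_lieI:
  assumes simple: "simple_lie_algebra br" and "killing br a b \<noteq> 0"
  shows "nondeg_lie br"
proof -
  interpret complex_lie br
    using simple by unfold_locales (simp add: simple_lie_algebra_def)
  let ?I = "{a. \<forall>b. killing br a b = 0}"
  have "lie_ideal br ?I"
    unfolding lie_ideal_def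
  proof (intro conjI allI ballI)
    show "vec.subspace ?I"
      by (simp add: vec.subspace_def killing_sym[of _ "_::complex^'a"] killing_add killing_scale)
         (metis killing_add killing_scale killing_sym add_0 mult_zero_right mult_zero_left vec.scale_zero_left)
    fix a b assume b: "b \<in> ?I"
    have "killing br (br a b) c = killing br b (br c a)" for c
      by (metis killing_sym killing_invariant)
    then show "br a b \<in> ?I" using b by simp
  qed
  then have "?I = {0} \<or> ?I = UNIV" using simple by (simp add: simple_lie_algebra_def)
  then have "?I = {0}" using assms(2) by blast
  then show ?thesis by unfold_locales blast
qed

section \<open>Tensors\<close>

lemma clinearI:
  "(\<And>x y. f (x + y) = f x + f y) \<Longrightarrow> (\<And>c x. f (c *s x) = c *s f x) \<Longrightarrow> clinear f"
  by (simp add: Vector_Spaces.linear_iff vec.vector_space_axioms)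

lemma tensor2_eq_iff: "(T :: 'n::finite tensor2) = S \<longleftrightarrow> (\<forall>i j. T $ (i, j) = S $ (i, j))"
  by (auto simp: vec_eq_iff)

lemma tens2_add_left: "tens2 (a + b) c = tens2 a c + tens2 b c"
  and tens2_add_right: "tens2 c (a + b) = tens2 c a + tens2 c b"
  and tens2_scale_left: "tens2 (k *s a) c = k *s tens2 a c"
  and tens2_scale_right: "tens2 a (k *s c) = k *s tens2 a c"
  by (auto simp: tensor2_eq_iff tens2_def algebra_simps)

lemma tens3_add: 
  "tens3 (a + b) c d = tens3 a c d + tens3 b c d"
  "tens3 c (a + b) d = tens3 c a d + tens3 c b d"
  "tens3 c d (a + b) = tens3 c d a + tens3 c d b"
  by (auto simp: vec_eq_iff tens3_def algebra_simps)

lemma tens3_scale: 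
  "tens3 (k *s a) c d = k *s tens3 a c d"
  "tens3 a (k *s c) d = k *s tens3 a c d"
  "tens3 a c (k *s d) = k *s tens3 a c d"
  by (auto simp: vec_eq_iff tens3_def algebra_simps)

definition bilin :: "(complex^'a \<Rightarrow> complex^'b \<Rightarrow> complex^'c) \<Rightarrow> bool" where
  "bilin B \<longleftrightarrow> (\<forall>a. clinear (B a)) \<and> (\<forall>b. clinear (\<lambda>a. B a b))"

lemma bilin_expand:
  assumes "bilin B"
  shows "B a b = (\<Sum>i\<in>UNIV. \<Sum>j\<in>UNIV. (a $ i * b $ j) *s B (axis i 1) (axis j 1))"
proof -
  have l: "clinear (B a)" and r: "clinear (\<lambda>a. B a b)" for a b
    using assms by (auto simp: bilin_def)
  have "B a b = B (\<Sum>i\<in>UNIV. a $ i *s axis i 1) (\<Sum>i\<in>UNIV. b $ i *s axis i 1)"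
    by (simp only: basis_expansion)
  also have "\<dots> = (\<Sum>i\<in>UNIV. \<Sum>j\<in>UNIV. (a $ i * b $ j) *s B (axis i 1) (axis j 1))"
    by (simp add: vec.linear_sum[OF l] vec.linear_scale[OF l] vec.linear_sum[OF r] vec.linear_scale[OF r]
      vec.scale_sum_right) (subst sum.swap, simp add: mult.commute)
  finally show ?thesis .
qed

text \<open>The universal property of the tensor product in coordinates: the linear map induced by a
  bilinear \<open>B\<close>.\<close>

definition tlift :: "(complex^'a \<Rightarrow> complex^'a \<Rightarrow> complex^'b) \<Rightarrow> 'a tensor2 \<Rightarrow> complex^'b" where
  "tlift B T = (\<Sum>i\<in>UNIV. \<Sum>j\<in>UNIV. T $ (i, j) *s B (axis i 1) (axis j 1))"

lemma tlift_linear: "clinear (tlift B)"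
  by (rule clinearI)
    (simp_all add: tlift_def vec.scale_left_distrib sum.distrib vec.scale_sum_right)

lemmas tlift_add = vec.linear_add[OF tlift_linear]
  and tlift_scale = vec.linear_scale[OF tlift_linear]
  and tlift_minus = vec.linear_neg[OF tlift_linear]
  and tlift_sum = vec.linear_sum[OF tlift_linear]

lemma tlift_tens2:
  assumes "bilin B"
  shows "tlift B (tens2 a b) = B a b"
  by (subst bilin_expand[OF assms]) (simp add: tlift_def tens2_def)

lemma linear_tlift:
  assumes "clinear F"
  shows "F (tlift B T) = tlift (\<lambda>a b. F (B a b)) T"
  by (simp add: tlift_def vec.linear_sum[OF assms] vec.linear_scale[OF assms])

lemma tlift_add_fun: "tlift (\<lambda>a b. B a b + C a b) T = tlift B T + tlift C T"
  by (simp add: tlift_def vec.scale_right_distrib sum.distrib)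

lemma tlift_scale_fun: "tlift (\<lambda>a b. c *s B a b) T = c *s tlift B T"
  by (simp add: tlift_def vec.scale_sum_right mult.commute)

lemma tlift_flip: "tlift B (tens2_flip T) = tlift (\<lambda>a b. B b a) T"
  unfolding tlift_def tens2_flip_def by (subst sum.swap) simp

lemma tlift_swap:
  "tlift (\<lambda>a b. tlift (B a b) S) T = tlift (\<lambda>c d. tlift (\<lambda>a b. B a b c d) T) S"
proof -
  have pairs: "tlift C U = (\<Sum>x\<in>UNIV. U $ x *s C (axis (fst x) 1) (axis (snd x) 1))"
    for C :: "complex^'d \<Rightarrow> complex^'d \<Rightarrow> complex^'e" and U
    by (simp add: tlift_def sum.cartesian_product case_prod_beta)
  show ?thesis
    unfolding pairs vec.scale_sum_right by (subst sum.swap) (simp add: mult.commute)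
qed

lemma tens2_map_tlift: "tens2_map f g T = tlift (\<lambda>a b. tens2 (f a) (g b)) T"
  by (simp add: tens2_map_def tlift_def)

lemma tens2_map_nth:
  "tens2_map f g T $ (p, q) = (\<Sum>i\<in>UNIV. \<Sum>j\<in>UNIV. T $ (i, j) * (f (axis i 1) $ p * g (axis j 1) $ q))"
  by (simp add: tens2_map_def tens2_def)

lemma tlift_tens2_map:
  assumes "bilin B"
  shows "tlift B (tens2_map f g T) = tlift (\<lambda>a b. B (f a) (g b)) T"
  by (simp add: tens2_map_def tlift_sum tlift_scale tlift_tens2[OF assms]) (simp add: tlift_def)

lemma bilin_tens2:
  assumes "clinear f" "clinear g"
  shows "bilin (\<lambda>a b. tens2 (f a) (g b))"
  unfolding bilin_def using assms
  by (auto intro!: clinearI simp: vec.linear_add vec.linear_scale tens2_add_left tens2_add_right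
      tens2_scale_left tens2_scale_right)

lemma tens2_map_comp:
  assumes "clinear f" "clinear g"
  shows "tens2_map f g (tens2_map f' g' T) = tens2_map (\<lambda>a. f (f' a)) (\<lambda>b. g (g' b)) T"
  by (simp add: tens2_map_tlift[of f g] tlift_tens2_map[OF bilin_tens2[OF assms]]) (simp add: tens2_map_tlift)

lemma tens2_map_tens2:
  assumes "clinear f" "clinear g"
  shows "tens2_map f g (tens2 a b) = tens2 (f a) (g b)"
  by (simp add: tens2_map_tlift tlift_tens2[OF bilin_tens2[OF assms]])

lemma tens2_map_ident: "tens2_map (\<lambda>x. x) (\<lambda>x. x) T = T"
  by (simp add: tensor2_eq_iff tens2_map_nth axis_def if_distrib[of "\<lambda>x. _ * x"] cong: if_cong)

lemma tens2_map_linear: "clinear (tens2_map f g)"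
  using tlift_linear[of "\<lambda>a b. tens2 (f a) (g b)"] by (simp add: tens2_map_tlift[abs_def])

lemma tens2_map_add_left: "tens2_map (\<lambda>a. f a + f' a) g T = tens2_map f g T + tens2_map f' g T"
  by (simp add: tens2_map_tlift tens2_add_left tlift_add_fun)

lemma tens2_map_scale_left: "tens2_map (\<lambda>a. c *s f a) g T = c *s tens2_map f g T"
  by (simp add: tens2_map_tlift tens2_scale_left tlift_scale_fun)

lemma tens2_flip_linear: "clinear tens2_flip"
  by (rule clinearI) (simp_all add: tensor2_eq_iff tens2_flip_def)

lemma tens2_flip_tens2: "tens2_flip (tens2 a b) = tens2 b a"
  by (simp add: tensor2_eq_iff tens2_flip_def tens2_def)

lemma tens2_flip_map: "tens2_flip (tens2_map f g T) = tens2_map g f (tens2_flip T)"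
  by (simp add: tens2_map_tlift linear_tlift[OF tens2_flip_linear] tens2_flip_tens2 tlift_flip)

definition tlift3 :: "(complex^'a \<Rightarrow> complex^'a \<Rightarrow> complex^'a \<Rightarrow> complex^'b) \<Rightarrow> 'a tensor3 \<Rightarrow> complex^'b" where
  "tlift3 B T = (\<Sum>i\<in>UNIV. \<Sum>j\<in>UNIV. \<Sum>k\<in>UNIV. T $ (i, j, k) *s B (axis i 1) (axis j 1) (axis k 1))"

lemma tlift3_linear: "clinear (tlift3 B)"
  by (rule clinearI)
    (simp_all add: tlift3_def vec.scale_left_distrib sum.distrib vec.scale_sum_right)

lemma tlift3_tens3:
  assumes "\<And>a. bilin (B a)" "\<And>b c. clinear (\<lambda>a. B a b c)"
  shows "tlift3 B (tens3 a b c) = B a b c"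
proof -
  have "B a b c = B (\<Sum>i\<in>UNIV. a $ i *s axis i 1) b c" by (simp only: basis_expansion)
  also have "\<dots> = (\<Sum>i\<in>UNIV. a $ i *s B (axis i 1) b c)"
    by (simp add: vec.linear_sum[OF assms(2)] vec.linear_scale[OF assms(2)])
  also have "\<dots> = (\<Sum>i\<in>UNIV. a $ i *s (\<Sum>j\<in>UNIV. \<Sum>k\<in>UNIV. (b $ j * c $ k) *s B (axis i 1) (axis j 1) (axis k 1)))"
    using bilin_expand[OF assms(1)] by metis
  also have "\<dots> = tlift3 B (tens3 a b c)"
    by (simp add: tlift3_def tens3_def vec.scale_sum_right mult.assoc)
  finally show ?thesis ..
qed

lemma br_12_13_tlift:
  "br_12_13 br r s = tlift (\<lambda>a b. tlift (\<lambda>c d. tens3 (br a c) b d) s) r"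
  and br_12_23_tlift:
  "br_12_23 br r s = tlift (\<lambda>a b. tlift (\<lambda>c d. tens3 a (br b c) d) s) r"
  and br_13_23_tlift:
  "br_13_23 br r s = tlift (\<lambda>a b. tlift (\<lambda>c d. tens3 a c (br b d)) s) r"
  by (simp_all add: br_12_13_def br_12_23_def br_13_23_def tlift_def vec.scale_sum_right)

section \<open>Contraction of the Yang-Baxter equation, and its invariance under
  automorphisms\<close>

context complex_lie
begin

lemmas br_simps = br_add_left br_add_right br_scale_left br_scale_right
lemmas tens_simps = tens2_add_left tens2_add_right tens2_scale_left tens2_scale_right tens3_add tens3_scale

lemma bilin_br: "bilin br"
  by (auto simp: bilin_def intro: lin_left lin_right)

text \<open>Bracketing the first two legs of \<open>[r12, s23]\<close> lets \<open>r\<close> act on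
  the first leg of \<open>s\<close> through this endomorphism; \<open>acts_left\<close> plays the
  same part for \<open>[r12, s13]\<close>.\<close>

definition acts_right :: "'n tensor2 \<Rightarrow> complex^'n \<Rightarrow> complex^'n" where
  "acts_right r c = tlift (\<lambda>a b. br a (br b c)) r"

definition acts_left :: "'n tensor2 \<Rightarrow> complex^'n \<Rightarrow> complex^'n" where
  "acts_left r c = tlift (\<lambda>a b. br (br a c) b) r"

definition tensor_square :: "'n tensor2 \<Rightarrow> 'n tensor2 \<Rightarrow> 'n tensor2" where
  "tensor_square r s = tlift (\<lambda>a b. tlift (\<lambda>c d. tens2 (br a c) (br b d)) s) r"

text \<open>The Jacobi identity. When both endomorphisms are applied to the same tensor, their sum
  is an inner derivation; this is the origin of \<open>ad f\<close>.\<close>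

lemma acts_left_right: "acts_left r c + acts_right r c = br (tlift br r) c"
proof -
  have "br (tlift br r) c = tlift (\<lambda>a b. br (br a b) c) r"
    by (rule linear_tlift[OF lin_left])
  also have "(\<lambda>a b. br (br a b) c) = (\<lambda>a b. br (br a c) b + br a (br b c))"
  proof (intro ext)
    fix a b
    have "br b (br a c) = - br (br a c) b" by (rule br_antisym)
    then show "br (br a b) c = br (br a c) b + br a (br b c)"
      using jacobi[of a b c] by simp
  qed
  finally show ?thesis by (simp add: tlift_add_fun acts_left_def acts_right_def)
qed

lemma acts_left_add: "acts_left (r + s) c = acts_left r c + acts_left s c"
  and acts_left_scale: "acts_left (k *s r) c = k *s acts_left r c"
  and acts_right_add: "acts_right (r + s) c = acts_right r c + acts_right s c"
  and acts_right_scale: "acts_right (k *s r) c = k *s acts_right r c"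
  by (simp_all add: acts_left_def acts_right_def tlift_add tlift_scale)

abbreviation contract :: "'n tensor3 \<Rightarrow> 'n tensor2" where
  "contract \<equiv> tlift3 (\<lambda>a b c. tens2 (br a b) c)"

lemma contract_tens3: "contract (tens3 a b c) = tens2 (br a b) c"
  by (rule tlift3_tens3) (auto intro!: clinearI simp: bilin_def br_simps tens_simps)

lemma contract_12_13: "contract (br_12_13 br r s) = tens2_map (acts_left r) (\<lambda>x. x) s"
proof -
  have *: "tens2 (acts_left r c) d = tlift (\<lambda>a b. tens2 (br (br a c) b) d) r" for c d
    unfolding acts_left_def by (rule linear_tlift) (rule clinearI; simp add: tens_simps)
  show ?thesis
    by (simp add: br_12_13_tlift linear_tlift[OF tlift3_linear] contract_tens3 tens2_map_tlift *)
      (rule tlift_swap)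
qed

lemma contract_12_23: "contract (br_12_23 br r s) = tens2_map (acts_right r) (\<lambda>x. x) s"
proof -
  have *: "tens2 (acts_right r c) d = tlift (\<lambda>a b. tens2 (br a (br b c)) d) r" for c d
    unfolding acts_right_def by (rule linear_tlift) (rule clinearI; simp add: tens_simps)
  show ?thesis
    by (simp add: br_12_23_tlift linear_tlift[OF tlift3_linear] contract_tens3 tens2_map_tlift *)
      (rule tlift_swap)
qed

lemma contract_13_23: "contract (br_13_23 br r s) = tensor_square r s"
  by (simp add: br_13_23_tlift linear_tlift[OF tlift3_linear] contract_tens3 tensor_square_def)

lemma tens2_flip_tensor_square: "tens2_flip (tensor_square r s) = tensor_square (tens2_flip r) (tens2_flip s)"
  by (simp add: tensor_square_def linear_tlift[OF tens2_flip_linear] tens2_flip_tens2 tlift_flip)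

lemma tensor_square_minus: "tensor_square (- r) (- s) = tensor_square r s"
proof -
  have "tensor_square (- r) (- s) = (-1) *s ((-1) *s tensor_square r s)"
    unfolding tensor_square_def vec.scale_minus_left vec.scale_one
    by (simp add: tlift_minus linear_tlift[OF vec.linear_uminus, symmetric])
  then show ?thesis by simp
qed

definition tens3_map where
  "tens3_map f g h T = tlift3 (\<lambda>a b c. tens3 (f a) (g b) (h c)) T"

lemma tens3_map_linear: "clinear (tens3_map f g h)"
  unfolding tens3_map_def[abs_def] by (rule tlift3_linear)

lemma tens3_map_tens3:
  assumes "clinear f" "clinear g" "clinear h"
  shows "tens3_map f g h (tens3 a b c) = tens3 (f a) (g b) (h c)"
  unfolding tens3_map_def
  by (rule tlift3_tens3)
    (auto intro!: clinearI simp: bilin_def tens_simps vec.linear_add[OF assms(1)] vec.linear_add[OF assms(2)]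
      vec.linear_add[OF assms(3)] vec.linear_scale[OF assms(1)] vec.linear_scale[OF assms(2)] vec.linear_scale[OF assms(3)])

lemma tlift_tlift_tens2_map:
  assumes "\<And>c d. bilin (\<lambda>a b. B a b c d)" "\<And>a b. bilin (B a b)"
  shows "tlift (\<lambda>a b. tlift (B a b) (tens2_map h k s)) (tens2_map f g r) =
    tlift (\<lambda>a b. tlift (\<lambda>c d. B (f a) (g b) (h c) (k d)) s) r"
proof -
  have l: "clinear (\<lambda>b. B a b c d)" and r: "clinear (\<lambda>a. B a b c d)" for a b c d
    using assms(1) by (auto simp: bilin_def)
  have "bilin (\<lambda>a b. tlift (\<lambda>c d. B a b (h c) (k d)) s)"
    unfolding bilin_def
    by (auto intro!: clinearI simp: tlift_def vec.linear_add[OF l] vec.linear_scale[OF l] vec.linear_add[OF r] vec.linear_scale[OF r]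
        vec.scale_right_distrib sum.distrib vec.scale_sum_right mult.commute)
  then show ?thesis
    by (simp add: tlift_tens2_map[OF assms(2)] tlift_tens2_map)
qed

text \<open>Automorphisms commute with the bracket in each leg. Each leg has its own automorphism
  because the gauge takes different values at the three points.\<close>

lemma
  assumes f: "lie_automorphism br f" and g: "lie_automorphism br g" and h: "lie_automorphism br h"
  shows tens3_map_br_12_13: "br_12_13 br (tens2_map f g r) (tens2_map f h s) = tens3_map f g h (br_12_13 br r s)"
    and tens3_map_br_12_23: "br_12_23 br (tens2_map f g r) (tens2_map g h s) = tens3_map f g h (br_12_23 br r s)"
    and tens3_map_br_13_23: "br_13_23 br (tens2_map f h r) (tens2_map g h s) = tens3_map f g h (br_13_23 br r s)"
proof -
  have lin: "clinear f" "clinear g" "clinear h"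
    and br: "br (f a) (f b) = f (br a b)" "br (g a) (g b) = g (br a b)" "br (h a) (h b) = h (br a b)" for a b
    using assms by (auto simp: lie_automorphism_def)
  show "br_12_13 br (tens2_map f g r) (tens2_map f h s) = tens3_map f g h (br_12_13 br r s)"
    unfolding br_12_13_tlift
    by (subst tlift_tlift_tens2_map)
      (auto intro!: clinearI simp: br linear_tlift[OF tens3_map_linear] tens3_map_tens3[OF lin] bilin_def br_simps tens_simps)
  show "br_12_23 br (tens2_map f g r) (tens2_map g h s) = tens3_map f g h (br_12_23 br r s)"
    unfolding br_12_23_tlift
    by (subst tlift_tlift_tens2_map)
      (auto intro!: clinearI simp: br linear_tlift[OF tens3_map_linear] tens3_map_tens3[OF lin] bilin_def br_simps tens_simps)
  show "br_13_23 br (tens2_map f h r) (tens2_map g h s) = tens3_map f g h (br_13_23 br r s)"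
    unfolding br_13_23_tlift
    by (subst tlift_tlift_tens2_map)
      (auto intro!: clinearI simp: br linear_tlift[OF tens3_map_linear] tens3_map_tens3[OF lin] bilin_def br_simps tens_simps)
qed

end

context nondeg_lie
begin

lemma acts_right_casimir: "acts_right (casimir br) c = c"
  and acts_left_casimir: "acts_left (casimir br) c = - c"
  unfolding acts_right_def acts_left_def tlift_def
  by (rule casimir_acts_right, rule casimir_acts_left)

text \<open>The Casimir element acts by \<open>-1\<close> on \<open>r13\<close> and by
  \<open>+1\<close> on \<open>r23\<close>, and these contributions are moved to the left. With
  \<open>c = 1 / (u - t)\<close> and \<open>S\<close> the regular part of \<open>r12\<close>, the
  left side is a difference quotient.\<close>

lemma contracted_cybe:
  assumes cybe: "br_12_13 br r12 r13 + br_13_23 br r13 r23 + br_12_23 br r12 r23 = 0"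
    and split: "r12 = c *s casimir br + S"
  shows "c *s (r13 - r23) = tens2_map (acts_left S) (\<lambda>x. x) r13 + tens2_map (acts_right S) (\<lambda>x. x) r23 + tensor_square r13 r23"
proof -
  have "contract (br_12_13 br r12 r13 + br_13_23 br r13 r23 + br_12_23 br r12 r23) = 0"
    unfolding cybe by (rule vec.linear_0[OF tlift3_linear])
  then have eq: "tens2_map (acts_left r12) (\<lambda>x. x) r13 + tensor_square r13 r23 + tens2_map (acts_right r12) (\<lambda>x. x) r23 = 0"
    by (simp add: vec.linear_add[OF tlift3_linear] contract_12_13 contract_12_23 contract_13_23)
  have L: "tens2_map (acts_left r12) (\<lambda>x. x) r13 = - (c *s r13) + tens2_map (acts_left S) (\<lambda>x. x) r13"
  proof -
    have "acts_left r12 = (\<lambda>a. (- c) *s a + acts_left S a)"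
      by (rule ext) (simp add: split acts_left_add acts_left_scale acts_left_casimir)
    then show ?thesis
      by (simp only: tens2_map_add_left tens2_map_scale_left tens2_map_ident) simp
  qed
  have R: "tens2_map (acts_right r12) (\<lambda>x. x) r23 = c *s r23 + tens2_map (acts_right S) (\<lambda>x. x) r23"
  proof -
    have "acts_right r12 = (\<lambda>a. c *s a + acts_right S a)"
      by (rule ext) (simp add: split acts_right_add acts_right_scale acts_right_casimir)
    then show ?thesis
      by (simp only: tens2_map_add_left tens2_map_scale_left tens2_map_ident)
  qed
  show ?thesis using eq unfolding L R by (simp add: algebra_simps vec.scale_right_diff_distrib)
qed

end

section \<open>Linear differential equations\<close>

text \<open>Taylor coefficients at \<open>0\<close> of the solution of \<open>y' = B y\<close> with
  initial value \<open>y\<close>, where \<open>b i j\<close> is the coefficient sequence of the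
  entry \<open>(i, j)\<close> of \<open>B\<close>.\<close>

fun ode_coeff :: "('k \<Rightarrow> 'k \<Rightarrow> nat \<Rightarrow> complex) \<Rightarrow> complex^'k \<Rightarrow> nat \<Rightarrow> complex^'k" where
  "ode_coeff b y 0 = y"
| "ode_coeff b y (Suc n) =
    (\<chi> i. (\<Sum>k\<in>{..n}. \<Sum>j\<in>UNIV. b i j (n - k) * ode_coeff b y k $ j) / of_nat (Suc n))"

text \<open>
  The majorant consists of the coefficients of \<open>K * (1 - z) powr (- A)\<close>, which solves
  \<open>y' = A / (1 - z) * y\<close>.
\<close>

lemma ode_coeff_bound:
  fixes b :: "'k::finite \<Rightarrow> 'k \<Rightarrow> nat \<Rightarrow> complex"
  assumes b: "\<And>i j n. norm (b i j n) * R ^ n \<le> M" and R: "R > 0" and M: "M \<ge> 0"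
    and K: "\<And>i. norm (y $ i) \<le> K"
  defines "A \<equiv> R * (M * CARD('k))"
  shows "norm (ode_coeff b y n $ i) * R ^ n \<le> K * (pochhammer A n / fact n)"
proof (induction n arbitrary: i rule: less_induct)
  case (less n)
  define \<kappa> where "\<kappa> n = K * (pochhammer A n / fact n)" for n
  \<comment> \<open>The majorant equation in coefficients: multiplication by
    \<open>1 / (1 - z)\<close> forms partial sums. The factor \<open>R\<close> in \<open>A\<close>
    absorbs the index shift of the recursion.\<close>
  have sum: "A * (\<Sum>k\<le>n. \<kappa> k) = of_nat (Suc n) * \<kappa> (Suc n)" for n
  proof (induction n)
    case 0 show ?case by (simp add: \<kappa>_def)
  next
    case (Suc n)
    have "A * (\<Sum>k\<le>Suc n. \<kappa> k) = (of_nat (Suc n) + A) * \<kappa> (Suc n)"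
      using Suc by (simp add: algebra_simps)
    also have "\<dots> = of_nat (Suc (Suc n)) * \<kappa> (Suc (Suc n))"
      by (simp add: \<kappa>_def pochhammer_Suc divide_simps)
    finally show ?case .
  qed
  show ?case
  proof (cases n)
    case 0 with K show ?thesis by simp
  next
    case (Suc n')
    have "norm (ode_coeff b y n $ i) * R ^ n = 
        norm (\<Sum>k\<in>{..n'}. \<Sum>j\<in>UNIV. b i j (n' - k) * ode_coeff b y k $ j) * R ^ n / of_nat n"
      using Suc by (simp add: norm_divide del: of_nat_Suc)
    also have "\<dots> \<le> (\<Sum>k\<in>{..n'}. \<Sum>j\<in>UNIV. norm (b i j (n' - k)) * norm (ode_coeff b y k $ j)) * R ^ n / of_nat n"
      using R by (intro divide_right_mono mult_right_mono sum_norm_le order.trans[OF norm_sum] sum_mono)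
        (auto simp: norm_mult)
    also have "\<dots> = R * (\<Sum>k\<in>{..n'}. \<Sum>j\<in>UNIV. (norm (b i j (n' - k)) * R ^ (n' - k)) * (norm (ode_coeff b y k $ j) * R ^ k)) / of_nat n"
    proof -
      have "(\<Sum>k\<in>{..n'}. \<Sum>j\<in>UNIV. norm (b i j (n' - k)) * norm (ode_coeff b y k $ j)) * R ^ n =
         R * (\<Sum>k\<in>{..n'}. \<Sum>j\<in>UNIV. (norm (b i j (n' - k)) * R ^ (n' - k)) * (norm (ode_coeff b y k $ j) * R ^ k))"
        unfolding sum_distrib_left sum_distrib_right
      proof (intro sum.cong refl)
        fix k j assume "k \<in> {..n'}"
        then have "R ^ n = R * (R ^ (n' - k) * R ^ k)" using Suc by (simp flip: power_add)
        then show "norm (b i j (n' - k)) * norm (ode_coeff b y k $ j) * R ^ n = 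
          R * ((norm (b i j (n' - k)) * R ^ (n' - k)) * (norm (ode_coeff b y k $ j) * R ^ k))"
          by (simp add: algebra_simps)
      qed
      then show ?thesis by simp
    qed
    also have "\<dots> \<le> R * (\<Sum>k\<in>{..n'}. \<Sum>j\<in>(UNIV::'k set). M * \<kappa> k) / of_nat n"
    proof -
      have "norm (ode_coeff b y k $ j) * R ^ k \<le> \<kappa> k" if "k \<le> n'" for k j
        using less[of k j] that Suc by (simp add: \<kappa>_def)
      then show ?thesis
        using R b M by (intro divide_right_mono mult_left_mono sum_mono mult_mono) auto
    qed
    also have "\<dots> = A * (\<Sum>k\<le>n'. \<kappa> k) / of_nat n"
      by (simp add: A_def sum_distrib_left algebra_simps)
    also have "\<dots> = \<kappa> n" unfolding sum using Suc by (simp del: of_nat_Suc)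
    finally show ?thesis by (simp add: \<kappa>_def)
  qed
qed

text \<open>For entire coefficients the majorant is available with every \<open>R\<close>, so the
  radius of convergence exceeds every real number.\<close>

lemma ode_coeff_radius:
  fixes b :: "'k::finite \<Rightarrow> 'k \<Rightarrow> nat \<Rightarrow> complex"
  assumes b: "\<And>i j. conv_radius (b i j) = \<infinity>"
  shows "conv_radius (\<lambda>n. ode_coeff b y n $ i) = \<infinity>"
proof -
  have ge: "conv_radius (\<lambda>n. ode_coeff b y n $ i) \<ge> ereal r" if r: "r > 0" for r :: real
  proof -
    \<comment> \<open>Doubling the radius leaves a factor \<open>(1/2) ^ n\<close>, which dominates
      the polynomial growth of \<open>pochhammer A n / fact n\<close>.\<close>
    define R where "R = 2 * r"
    have R: "R > 0" using r by (simp add: R_def)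
    have "\<exists>M. \<forall>n. norm (b i j n) * R ^ n \<le> M" for i j
    proof -
      have "summable (\<lambda>n. b i j n * of_real R ^ n)"
        by (rule summable_in_conv_radius) (simp add: b)
      then have "Bseq (\<lambda>n. b i j n * of_real R ^ n)"
        using summable_LIMSEQ_zero convergentI convergent_imp_Bseq by blast
      then obtain M where "\<And>n. norm (b i j n * of_real R ^ n) \<le> M" by (auto simp: Bseq_def)
      then show ?thesis using R by (auto simp: norm_mult norm_power)
    qed
    then obtain M0 where M0: "\<And>i j n. norm (b i j n) * R ^ n \<le> M0 i j" by metis
    define M where "M = (\<Sum>i\<in>UNIV. \<Sum>j\<in>UNIV. \<bar>M0 i j\<bar>)"
    have M: "norm (b i j n) * R ^ n \<le> M" for i j n
    proof -
      have "norm (b i j n) * R ^ n \<le> \<bar>M0 i j\<bar>" using M0[of i j n] by linarith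
      also have "\<dots> \<le> (\<Sum>j\<in>UNIV. \<bar>M0 i j\<bar>)" by (rule member_le_sum) auto
      also have "\<dots> \<le> M" unfolding M_def
        by (rule member_le_sum[of i UNIV "\<lambda>i. \<Sum>j\<in>UNIV. \<bar>M0 i j\<bar>"]) (auto intro: sum_nonneg)
      finally show ?thesis .
    qed
    have M_nonneg: "M \<ge> 0" by (auto simp: M_def intro!: sum_nonneg)
    define A where "A = R * (M * CARD('k))"
    have A: "A \<ge> 0" using R M_nonneg by (simp add: A_def)
    define K where "K = norm y"
    have bound: "norm (ode_coeff b y n $ i) * R ^ n \<le> K * (pochhammer A n / fact n)" for n
      unfolding A_def by (rule ode_coeff_bound[OF M R M_nonneg]) (simp add: K_def Finite_Cartesian_Product.norm_nth_le)
    have nonneg: "pochhammer A n \<ge> 0" for n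
      using A by (simp add: pochhammer_prod prod_nonneg)
    have "summable (\<lambda>n. K * (pochhammer A n / fact n) * (1/2) ^ n)"
    \<comment> \<open>The ratio \<open>(A + n) / (n + 1) * (1/2)\<close> tends to \<open>1/2\<close>
      and is at most \<open>3/4\<close> once \<open>2 * A \<le> n\<close>.\<close>
    proof (rule summable_ratio_test[where c = "3/4" and N = "nat \<lceil>2 * A\<rceil>"])
      fix n assume n: "n \<ge> nat \<lceil>2 * A\<rceil>"
      then have "2 * A \<le> real n" by linarith
      then have le: "(A + n) / (n + 1) * (1/2) \<le> 3/4" by (simp add: field_simps)
      have "norm (K * (pochhammer A (Suc n) / fact (Suc n)) * (1/2) ^ Suc n) =
         ((A + n) / (n + 1) * (1/2)) * norm (K * (pochhammer A n / fact n) * (1/2) ^ n)"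
        using A nonneg[of n] by (simp add: pochhammer_Suc norm_mult norm_divide abs_mult divide_simps)
      also have "\<dots> \<le> 3/4 * norm (K * (pochhammer A n / fact n) * (1/2) ^ n)"
        by (rule mult_right_mono[OF le]) simp
      finally show "norm (K * (pochhammer A (Suc n) / fact (Suc n)) * (1/2) ^ Suc n) \<le>
        3/4 * norm (K * (pochhammer A n / fact n) * (1/2) ^ n)" .
    qed simp
    then have "summable (\<lambda>n. ode_coeff b y n $ i * of_real r ^ n)"
    proof (rule summable_comparison_test'[where N = 0])
      fix n
      have "norm (ode_coeff b y n $ i * of_real r ^ n) = norm (ode_coeff b y n $ i) * R ^ n * (1/2) ^ n"
        using r by (simp add: norm_mult norm_power R_def power_mult_distrib power_divide)
      also have "\<dots> \<le> K * (pochhammer A n / fact n) * (1/2) ^ n"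
        by (rule mult_right_mono[OF bound]) simp
      finally show "norm (ode_coeff b y n $ i * of_real r ^ n) \<le> K * (pochhammer A n / fact n) * (1/2) ^ n" .
    qed
    from conv_radius_geI[OF this] show ?thesis using r by simp
  qed
  show ?thesis
  proof (rule ereal_top)
    fix B :: real
    show "ereal B \<le> conv_radius (\<lambda>n. ode_coeff b y n $ i)"
      using ge[of "max B 1"] by (meson ereal_less_eq(3) less_max_iff_disj max.cobounded1 order.trans zero_less_one)
  qed
qed

text \<open>Stated entry by entry because \<open>has_field_derivative\<close> concerns functions
  with values in a field.\<close>

definition vec_deriv :: "(complex \<Rightarrow> complex^'k) \<Rightarrow> complex^'k \<Rightarrow> complex \<Rightarrow> bool" where
  "vec_deriv y y' z \<longleftrightarrow> (\<forall>i. ((\<lambda>z. y z $ i) has_field_derivative y' $ i) (at z))"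

definition mat_deriv :: "(complex \<Rightarrow> complex^'k^'l) \<Rightarrow> complex^'k^'l \<Rightarrow> complex \<Rightarrow> bool" where
  "mat_deriv Y Y' z \<longleftrightarrow> (\<forall>i j. ((\<lambda>z. Y z $ i $ j) has_field_derivative Y' $ i $ j) (at z))"

lemma linear_ode_entire:
  fixes B :: "complex \<Rightarrow> complex^'k^'k"
  assumes hol: "\<And>i j. (\<lambda>z. B z $ i $ j) holomorphic_on UNIV"
  shows "\<exists>y. y 0 = y0 \<and> (\<forall>z. vec_deriv y (B z *v y z) z)"
proof -
  define b where "b i j = fps_expansion (\<lambda>z. B z $ i $ j) 0" for i j
  have hol': "(\<lambda>z. B z $ i $ j) holomorphic_on eball 0 \<infinity>" for i j
    using hol[of i j] by (rule holomorphic_on_subset) simp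
  have rad_b: "fps_conv_radius (b i j) = \<infinity>" for i j
    using conv_radius_fps_expansion[OF hol'[of i j]] by (simp add: b_def)
  have eval_b: "eval_fps (b i j) z = B z $ i $ j" for i j z
    using eval_fps_expansion'[OF hol'[of i j], of z] by (simp add: b_def)
  define c where "c = ode_coeff (\<lambda>i j. fps_nth (b i j)) y0"
  define F where "F i = Abs_fps (\<lambda>n. c n $ i)" for i
  have rad_F: "fps_conv_radius (F i) = \<infinity>" for i
    using ode_coeff_radius[of "\<lambda>i j. fps_nth (b i j)" y0 i] rad_b
    by (simp add: fps_conv_radius_def F_def c_def)
  have rad_bF: "fps_conv_radius (b i j * F j) = \<infinity>" for i j
    using fps_conv_radius_mult[of "b i j" "F j"] by (simp add: rad_b rad_F)
  have deriv_F: "fps_deriv (F i) = (\<Sum>j\<in>UNIV. b i j * F j)" for i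
  proof (rule fps_ext)
    fix n
    have "fps_nth (fps_deriv (F i)) n = (\<Sum>k\<le>n. \<Sum>j\<in>UNIV. fps_nth (b i j) (n - k) * c k $ j)"
      by (simp add: F_def c_def del: of_nat_Suc)
    also have "\<dots> = (\<Sum>j\<in>UNIV. \<Sum>k\<le>n. fps_nth (b i j) (n - k) * c k $ j)"
      by (rule sum.swap)
    also have "\<dots> = fps_nth (\<Sum>j\<in>UNIV. F j * b i j) n"
      unfolding fps_sum_nth fps_mult_nth by (simp add: F_def atMost_atLeast0 mult.commute)
    finally show "fps_nth (fps_deriv (F i)) n = fps_nth (\<Sum>j\<in>UNIV. b i j * F j) n"
      by (simp add: mult.commute)
  qed
  have eval_sum: "fps_conv_radius (\<Sum>j\<in>J. b i j * F j) = \<infinity> \<and> 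
      eval_fps (\<Sum>j\<in>J. b i j * F j) z = (\<Sum>j\<in>J. B z $ i $ j * eval_fps (F j) z)" for i J z
  proof (induction J rule: infinite_finite_induct)
    case (insert j J)
    then show ?case
      using fps_conv_radius_add[of "b i j * F j" "\<Sum>j\<in>J. b i j * F j"]
      by (simp add: rad_bF eval_fps_add eval_fps_mult rad_b rad_F eval_b)
  qed auto
  define y where "y z = (\<chi> i. eval_fps (F i) z)" for z
  have "y 0 = y0" by (simp add: y_def vec_eq_iff eval_fps_at_0 F_def c_def)
  moreover have "vec_deriv y (B z *v y z) z" for z
    unfolding vec_deriv_def
  proof
    fix i
    have "(eval_fps (F i) has_field_derivative eval_fps (fps_deriv (F i)) z) (at z)"
      by (rule has_field_derivative_eval_fps) (simp add: rad_F)
    then show "((\<lambda>z. y z $ i) has_field_derivative (B z *v y z) $ i) (at z)"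
      by (simp add: y_def matrix_vector_mult_def deriv_F eval_sum)
  qed
  ultimately show ?thesis by blast
qed

lemma vec_deriv_const: "vec_deriv (\<lambda>z. v) 0 z"
  by (simp add: vec_deriv_def)

lemma vec_deriv_bilin:
  assumes "bilin B" "vec_deriv a a' z" "vec_deriv b b' z"
  shows "vec_deriv (\<lambda>z. B (a z) (b z)) (B a' (b z) + B (a z) b') z"
  unfolding vec_deriv_def
proof
  fix p
  have "((\<lambda>z. \<Sum>i\<in>UNIV. \<Sum>j\<in>UNIV. (a z $ i * b z $ j) * B (axis i 1) (axis j 1) $ p) has_field_derivative
      (\<Sum>i\<in>UNIV. \<Sum>j\<in>UNIV. (a' $ i * b z $ j + a z $ i * b' $ j) * B (axis i 1) (axis j 1) $ p)) (at z)"
    using assms(2,3) unfolding vec_deriv_def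
    by (intro DERIV_sum DERIV_cmult_right) (auto intro!: derivative_eq_intros)
  moreover have "(B a' (b z) + B (a z) b') $ p =
      (\<Sum>i\<in>UNIV. \<Sum>j\<in>UNIV. (a' $ i * b z $ j + a z $ i * b' $ j) * B (axis i 1) (axis j 1) $ p)"
    by (simp add: bilin_expand[OF assms(1), of a'] bilin_expand[OF assms(1), of "a z"] sum.distrib[symmetric] algebra_simps)
  moreover have "(\<lambda>z. B (a z) (b z) $ p) = (\<lambda>z. \<Sum>i\<in>UNIV. \<Sum>j\<in>UNIV. (a z $ i * b z $ j) * B (axis i 1) (axis j 1) $ p)"
    by (rule ext, subst bilin_expand[OF assms(1)]) simp
  ultimately show "((\<lambda>z. B (a z) (b z) $ p) has_field_derivative (B a' (b z) + B (a z) b') $ p) (at z)"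
    by simp
qed

lemma vec_deriv_matrix:
  assumes "mat_deriv M M' z" "vec_deriv y y' z"
  shows "vec_deriv (\<lambda>z. M z *v y z) (M' *v y z + M z *v y') z"
  using assms unfolding vec_deriv_def mat_deriv_def
  by (auto simp: matrix_vector_mult_def sum.distrib[symmetric] intro!: derivative_eq_intros sum.cong)

lemma vec_deriv_zero_constant:
  assumes "\<And>z. vec_deriv y 0 z"
  shows "y z = y 0"
proof -
  have "y z $ i = y 0 $ i" for i
    using has_field_derivative_zero_constant[of UNIV "\<lambda>z. y z $ i"] assms
    by (auto simp: vec_deriv_def)
  then show ?thesis by (simp add: vec_eq_iff)
qed

section \<open>Construction of the gauge transformation\<close>

context complex_lie
begin

text \<open>The fundamental matrix \<open>\<Theta>\<close> of \<open>X' = [f, X]\<close> and the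
  solution \<open>\<Phi>\<close> of the adjoint equation are inverse to each other. As
  \<open>ad f\<close> is a derivation, the bracket of two solutions is again a solution, so
  \<open>\<Theta>\<close> and hence \<open>\<Phi>\<close> preserve the bracket.\<close>

lemma gauge_exists:
  fixes f :: "complex \<Rightarrow> complex^'n"
  assumes f: "\<And>i. (\<lambda>z. f z $ i) holomorphic_on UNIV"
  obtains \<Phi> where "\<Phi> 0 = mat 1" "\<And>z. mat_deriv \<Phi> (- (\<Phi> z ** matrix (br (f z)))) z"
    "\<And>z. lie_automorphism br ((*v) (\<Phi> z))"
proof -
  define A where "A z = matrix (br (f z))" for z
  have A_works: "A z *v x = br (f z) x" for z x by (simp add: A_def ad_works)
  have A_hol: "(\<lambda>z. A z $ i $ j) holomorphic_on UNIV" for i j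
  proof -
    have "A z $ i $ j = (\<Sum>k\<in>UNIV. f z $ k * br (axis k 1) (axis j 1) $ i)" for z
    proof -
      have "A z $ i $ j = br (f z) (axis j 1) $ i" by (simp add: A_def matrix_def)
      also have "\<dots> = br (\<Sum>k\<in>UNIV. f z $ k *s axis k 1) (axis j 1) $ i" by (simp only: basis_expansion)
      finally show ?thesis by (simp add: br_sum_left br_scale_left)
    qed
    then show ?thesis using f by (simp add: holomorphic_intros)
  qed
  have "\<exists>y. y 0 = axis j 1 \<and> (\<forall>z. vec_deriv y (A z *v y z) z)" for j
    by (rule linear_ode_entire[OF A_hol])
  then obtain t where t: "\<And>j. t j 0 = axis j 1" "\<And>j z. vec_deriv (t j) (A z *v t j z) z" by metis
  define \<Theta> where "\<Theta> z = (\<chi> i j. t j z $ i)" for z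
  have \<Theta>0: "\<Theta> 0 = mat 1" by (auto simp: \<Theta>_def t mat_def axis_def vec_eq_iff)
  have \<Theta>: "mat_deriv \<Theta> (A z ** \<Theta> z) z" for z
    using t(2)[of _ z] unfolding mat_deriv_def vec_deriv_def
    by (simp add: \<Theta>_def matrix_matrix_mult_def matrix_vector_mult_def)
  \<comment> \<open>The transpose appears because \<open>\<Phi>' = - \<Phi> ** A\<close> is a linear
    system for the rows of \<open>\<Phi>\<close>.\<close>
  have "\<exists>y. y 0 = axis j 1 \<and> (\<forall>z. vec_deriv y (- transpose (A z) *v y z) z)" for j
    by (rule linear_ode_entire) (simp add: transpose_def A_hol holomorphic_intros)
  then obtain s where s: "\<And>j. s j 0 = axis j 1" "\<And>j z. vec_deriv (s j) (- transpose (A z) *v s j z) z" by metis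
  define \<Phi> where "\<Phi> z = (\<chi> i. s i z)" for z
  have \<Phi>0: "\<Phi> 0 = mat 1" by (auto simp: \<Phi>_def s mat_def axis_def vec_eq_iff)
  have \<Phi>: "mat_deriv \<Phi> (- (\<Phi> z ** A z)) z" for z
    using s(2)[of _ z] unfolding mat_deriv_def vec_deriv_def
    by (simp add: \<Phi>_def matrix_matrix_mult_def matrix_vector_mult_def transpose_def sum_negf mult.commute)
  have neg: "(- X) *v v = - (X *v v)" for X :: "complex^'n^'n" and v
    by (simp add: matrix_vector_mult_def vec_eq_iff sum_negf)
  have \<Theta>_vec: "vec_deriv (\<lambda>z. \<Theta> z *v v) (br (f z) (\<Theta> z *v v)) z" for v z
    using vec_deriv_matrix[OF \<Theta> vec_deriv_const[of v z]]
    by (simp add: matrix_vector_mul_assoc[symmetric] A_works)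
  \<comment> \<open>The two contributions to the derivative of \<open>\<Phi> z *v X z\<close>
    cancel, so \<open>\<Phi>\<close> carries every solution back to its initial value.\<close>
  have conserved: "\<Phi> z *v X z = X 0" if X: "\<And>z. vec_deriv X (br (f z) (X z)) z" for X z
  proof -
    have "vec_deriv (\<lambda>z. \<Phi> z *v X z) 0 z" for z
      using vec_deriv_matrix[OF \<Phi> X, of z]
      by (simp add: neg matrix_vector_mul_assoc[symmetric] A_works)
    from vec_deriv_zero_constant[OF this] show ?thesis by (simp add: \<Phi>0)
  qed
  have inv: "\<Phi> z ** \<Theta> z = mat 1" for z
    unfolding matrix_eq using conserved[OF \<Theta>_vec]
    by (simp add: matrix_vector_mul_assoc[symmetric] \<Theta>0)
  then have inv': "\<Theta> z ** \<Phi> z = mat 1" for z using matrix_left_right_inverse by blast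
  have cancel: "\<Phi> z *v (\<Theta> z *v x) = x" "\<Theta> z *v (\<Phi> z *v x) = x" for z x
    by (simp_all add: matrix_vector_mul_assoc inv inv')
  have hom: "\<Phi> z *v br (\<Theta> z *v a) (\<Theta> z *v b) = br a b" for a b z
  proof -
    have "vec_deriv (\<lambda>z. br (\<Theta> z *v a) (\<Theta> z *v b)) (br (f z) (br (\<Theta> z *v a) (\<Theta> z *v b))) z" for z
      using vec_deriv_bilin[OF bilin_br \<Theta>_vec[where v = a] \<Theta>_vec[where v = b]] by (simp add: jacobi[of "f z" "\<Theta> z *v a"])
    from conserved[OF this] show ?thesis by (simp add: \<Theta>0)
  qed
  have "lie_automorphism br ((*v) (\<Phi> z))" for z
    unfolding lie_automorphism_def
  proof (intro conjI allI)
    show "bij ((*v) (\<Phi> z))" by (rule o_bij[of "(*v) (\<Theta> z)"]) (auto simp: cancel)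
    show "\<Phi> z *v br a b = br (\<Phi> z *v a) (\<Phi> z *v b)" for a b
      using hom[of z "\<Phi> z *v a" "\<Phi> z *v b"] by (simp add: cancel)
  qed simp
  with \<Phi>0 \<Phi> show ?thesis using that by (simp add: A_def)
qed

end

section \<open>Holomorphic functions of two variables\<close>

text \<open>Combines separately computed partial derivatives: the total derivative exists by
  hypothesis, and restriction to the coordinate lines identifies its coefficients as
  \<open>a\<close> and \<open>b\<close>.\<close>

lemma holomorphic2_on_chain:
  assumes "holomorphic2_on F S" "(p t, q t) \<in> S"
    and p: "(p has_field_derivative p') (at t)" and q: "(q has_field_derivative q') (at t)"
    and a: "((\<lambda>x. F (x, q t)) has_field_derivative a) (at (p t))"
    and b: "((\<lambda>y. F (p t, y)) has_field_derivative b) (at (q t))"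
  shows "((\<lambda>t. F (p t, q t)) has_field_derivative a * p' + b * q') (at t)"
proof -
  obtain a' b' where F: "(F has_derivative (\<lambda>h. a' * fst h + b' * snd h)) (at (p t, q t))"
    using assms(1,2) by (auto simp: holomorphic2_on_def)
  have chain: "((\<lambda>t. F (P t, Q t)) has_field_derivative a' * P' + b' * Q') (at s)"
    if "(P has_field_derivative P') (at s)" "(Q has_field_derivative Q') (at s)" "P s = p t" "Q s = q t" for P Q P' Q' s
  proof -
    have "((\<lambda>t. (P t, Q t)) has_derivative (\<lambda>h. (P' * h, Q' * h))) (at s)"
      using that(1,2) by (intro has_derivative_Pair) (auto simp: has_field_derivative_def)
    moreover have "(F has_derivative (\<lambda>h. a' * fst h + b' * snd h)) (at (P s, Q s))"
      using F that(3,4) by simp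
    ultimately have "((\<lambda>t. F (P t, Q t)) has_derivative (\<lambda>h. a' * (P' * h) + b' * (Q' * h))) (at s)"
      using has_derivative_compose by fastforce
    moreover have "(\<lambda>h. a' * (P' * h) + b' * (Q' * h)) = (*) (a' * P' + b' * Q')"
      by (auto simp: algebra_simps)
    ultimately show ?thesis by (simp add: has_field_derivative_def)
  qed
  have "a' = a"
    using chain[of "\<lambda>x. x" 1 "p t" "\<lambda>x. q t" 0] a by (auto intro: DERIV_unique)
  moreover have "b' = b"
    using chain[of "\<lambda>x. p t" 0 "q t" "\<lambda>x. x" 1] b by (auto intro: DERIV_unique)
  ultimately show ?thesis using chain[OF p q] by simp
qed

lemma holomorphic2_on_curve:
  assumes F: "holomorphic2_on F S" and p: "p holomorphic_on T" "open T" and q: "q holomorphic_on T"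
    and S: "\<And>t. t \<in> T \<Longrightarrow> (p t, q t) \<in> S"
  shows "(\<lambda>t. F (p t, q t)) holomorphic_on T"
  unfolding holomorphic_on_open[OF p(2)]
proof
  fix t assume t: "t \<in> T"
  obtain p' q' where p': "(p has_field_derivative p') (at t)" and q': "(q has_field_derivative q') (at t)"
    using p q t by (meson holomorphic_on_open)
  obtain a b where F: "(F has_derivative (\<lambda>h. a * fst h + b * snd h)) (at (p t, q t))"
    using F S[OF t] by (auto simp: holomorphic2_on_def)
  have "((\<lambda>t. (p t, q t)) has_derivative (\<lambda>h. (p' * h, q' * h))) (at t)"
    using p' q' by (intro has_derivative_Pair) (auto simp: has_field_derivative_def)
  from has_derivative_compose[OF this F]
  have "((\<lambda>t. F (p t, q t)) has_derivative (\<lambda>h. a * (p' * h) + b * (q' * h))) (at t)" by simp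
  moreover have "(\<lambda>h. a * (p' * h) + b * (q' * h)) = (*) (a * p' + b * q')"
    by (auto simp: algebra_simps)
  ultimately have "((\<lambda>t. F (p t, q t)) has_field_derivative a * p' + b * q') (at t)"
    by (simp add: has_field_derivative_def)
  then show "\<exists>f'. ((\<lambda>t. F (p t, q t)) has_field_derivative f') (at t)" by blast
qed

lemma holomorphic2_onI:
  "(\<And>z. z \<in> S \<Longrightarrow> (f has_derivative (\<lambda>h. a z * fst h + b z * snd h)) (at z)) \<Longrightarrow> holomorphic2_on f S"
  by (auto simp: holomorphic2_on_def)

lemma holomorphic2_onE:
  assumes "holomorphic2_on f S"
  obtains a b where "\<forall>z\<in>S. (f has_derivative (\<lambda>h. a z * fst h + b z * snd h)) (at z)"
  using assms unfolding holomorphic2_on_def by metis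

lemma holomorphic2_on_const: "holomorphic2_on (\<lambda>z. c) S"
  by (rule holomorphic2_onI[where a = "\<lambda>_. 0" and b = "\<lambda>_. 0"]) simp

lemma holomorphic2_on_fst: "holomorphic2_on fst S"
  by (rule holomorphic2_onI[where a = "\<lambda>_. 1" and b = "\<lambda>_. 0"]) (auto intro!: derivative_eq_intros)

lemma holomorphic2_on_snd: "holomorphic2_on snd S"
  by (rule holomorphic2_onI[where a = "\<lambda>_. 0" and b = "\<lambda>_. 1"]) (auto intro!: derivative_eq_intros)

lemma holomorphic2_on_add:
  assumes "holomorphic2_on f S" "holomorphic2_on g S"
  shows "holomorphic2_on (\<lambda>z. f z + g z) S"
proof -
  obtain a b where f: "\<forall>z\<in>S. (f has_derivative (\<lambda>h. a z * fst h + b z * snd h)) (at z)"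
    using assms(1) by (rule holomorphic2_onE)
  obtain c d where g: "\<forall>z\<in>S. (g has_derivative (\<lambda>h. c z * fst h + d z * snd h)) (at z)"
    using assms(2) by (rule holomorphic2_onE)
  show ?thesis
    by (rule holomorphic2_onI[where a = "\<lambda>z. a z + c z" and b = "\<lambda>z. b z + d z"])
      (use has_derivative_add[OF bspec[OF f] bspec[OF g]] in \<open>simp add: algebra_simps\<close>)
qed

lemma holomorphic2_on_mult:
  assumes "holomorphic2_on f S" "holomorphic2_on g S"
  shows "holomorphic2_on (\<lambda>z. f z * g z) S"
proof -
  obtain a b where f: "\<forall>z\<in>S. (f has_derivative (\<lambda>h. a z * fst h + b z * snd h)) (at z)"
    using assms(1) by (rule holomorphic2_onE)
  obtain c d where g: "\<forall>z\<in>S. (g has_derivative (\<lambda>h. c z * fst h + d z * snd h)) (at z)"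
    using assms(2) by (rule holomorphic2_onE)
  show ?thesis
    by (rule holomorphic2_onI[where a = "\<lambda>z. a z * g z + f z * c z" and b = "\<lambda>z. b z * g z + f z * d z"])
      (use has_derivative_mult[OF bspec[OF f] bspec[OF g]] in \<open>simp add: algebra_simps\<close>)
qed

lemma holomorphic2_on_diff:
  assumes "holomorphic2_on f S" "holomorphic2_on g S"
  shows "holomorphic2_on (\<lambda>z. f z - g z) S"
  using holomorphic2_on_add[OF assms(1) holomorphic2_on_mult[OF holomorphic2_on_const[of "-1"] assms(2)]] by simp

lemma holomorphic2_on_sum:
  "(\<And>i. i \<in> I \<Longrightarrow> holomorphic2_on (f i) S) \<Longrightarrow> holomorphic2_on (\<lambda>z. \<Sum>i\<in>I. f i z) S"
  by (induction I rule: infinite_finite_induct) (auto intro: holomorphic2_on_add holomorphic2_on_const)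

lemma holomorphic2_on_power: "holomorphic2_on f S \<Longrightarrow> holomorphic2_on (\<lambda>z. f z ^ n) S"
  by (induction n) (auto intro: holomorphic2_on_mult holomorphic2_on_const)

lemma holomorphic2_on_compose:
  assumes "holomorphic2_on u S" and f: "f holomorphic_on T" "open T" and "\<And>z. z \<in> S \<Longrightarrow> u z \<in> T"
  shows "holomorphic2_on (\<lambda>z. f (u z)) S"
proof -
  obtain a b where u: "\<forall>z\<in>S. (u has_derivative (\<lambda>h. a z * fst h + b z * snd h)) (at z)"
    using assms(1) by (rule holomorphic2_onE)
  show ?thesis
  proof (rule holomorphic2_onI[where a = "\<lambda>z. deriv f (u z) * a z" and b = "\<lambda>z. deriv f (u z) * b z"])
    fix z assume z: "z \<in> S"
    have "(f has_derivative (\<lambda>h. deriv f (u z) * h)) (at (u z))"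
      using holomorphic_derivI[OF f] assms(4)[OF z] by (simp add: has_field_derivative_def)
    from has_derivative_compose[OF bspec[OF u z] this]
    show "((\<lambda>z. f (u z)) has_derivative (\<lambda>h. deriv f (u z) * a z * fst h + deriv f (u z) * b z * snd h)) (at z)"
      by (simp add: algebra_simps)
  qed
qed

lemma holomorphic2_on_compose2:
  assumes "holomorphic2_on u S" "holomorphic2_on v S" "holomorphic2_on F T" "\<And>z. z \<in> S \<Longrightarrow> (u z, v z) \<in> T"
  shows "holomorphic2_on (\<lambda>z. F (u z, v z)) S"
proof -
  obtain a b where u: "\<forall>z\<in>S. (u has_derivative (\<lambda>h. a z * fst h + b z * snd h)) (at z)"
    using assms(1) by (rule holomorphic2_onE)
  obtain c d where v: "\<forall>z\<in>S. (v has_derivative (\<lambda>h. c z * fst h + d z * snd h)) (at z)"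
    using assms(2) by (rule holomorphic2_onE)
  obtain p q where F: "\<forall>z\<in>T. (F has_derivative (\<lambda>h. p z * fst h + q z * snd h)) (at z)"
    using assms(3) by (rule holomorphic2_onE)
  show ?thesis
  proof (rule holomorphic2_onI[where a = "\<lambda>z. p (u z, v z) * a z + q (u z, v z) * c z"
        and b = "\<lambda>z. p (u z, v z) * b z + q (u z, v z) * d z"])
    fix z assume z: "z \<in> S"
    from has_derivative_compose[OF has_derivative_Pair[OF bspec[OF u z] bspec[OF v z]] bspec[OF F assms(4)[OF z]]]
    show "((\<lambda>z. F (u z, v z)) has_derivative (\<lambda>h. (p (u z, v z) * a z + q (u z, v z) * c z) * fst h +
      (p (u z, v z) * b z + q (u z, v z) * d z) * snd h)) (at z)"
      by (simp add: algebra_simps)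
  qed
qed

lemma holomorphic2_on_isCont: "holomorphic2_on f S \<Longrightarrow> z \<in> S \<Longrightarrow> isCont f z"
  by (auto simp: holomorphic2_on_def intro: has_derivative_continuous)

text \<open>On each line with fixed second coordinate the zeros are isolated. This supplies the
  density clause of \<open>meromorphic2_at\<close> and \<open>generically_near\<close>.\<close>

lemma nonzero_dense:
  fixes q :: "complex \<times> complex \<Rightarrow> complex"
  assumes hol: "\<And>y. (\<lambda>x. q (x, y)) holomorphic_on UNIV" and nz: "\<And>y. \<exists>x. q (x, y) \<noteq> 0"
  shows "UNIV \<subseteq> closure {w \<in> UNIV. q w \<noteq> 0}"
proof
  fix w :: "complex \<times> complex"
  obtain x y where w: "w = (x, y)" by (cases w)
  obtain x' where "q (x', y) \<noteq> 0" using nz by blast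
  then have ev: "\<forall>\<^sub>F t in at x. q (t, y) \<noteq> 0 \<and> t \<in> UNIV"
    by (intro non_zero_neighbour_alt[OF hol]) auto
  show "w \<in> closure {w \<in> UNIV. q w \<noteq> 0}"
    unfolding closure_approachable
  proof (intro allI impI)
    fix e :: real assume "e > 0"
    then have "\<forall>\<^sub>F t in at x. dist t x < e" by (auto simp: eventually_at)
    with ev have "\<forall>\<^sub>F t in at x. q (t, y) \<noteq> 0 \<and> dist t x < e" by eventually_elim auto
    then obtain t where "q (t, y) \<noteq> 0" "dist t x < e"
      using eventually_happens[of _ "at x"] by auto
    then show "\<exists>v\<in>{w \<in> UNIV. q w \<noteq> 0}. dist v w < e"
      by (intro bexI[of _ "(t, y)"]) (auto simp: w dist_Pair_Pair)
  qed
qed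

section \<open>Limits of tensors\<close>

lemma tendsto_vec_scale:
  "(c \<longlongrightarrow> c0) F \<Longrightarrow> (v \<longlongrightarrow> v0) F \<Longrightarrow> ((\<lambda>x. c x *s v x) \<longlongrightarrow> (c0 *s v0 :: complex^'k)) F"
  by (rule vec_tendstoI) (auto intro!: tendsto_intros)

lemma tendsto_tlift:
  assumes "(r \<longlongrightarrow> r0) F" "\<And>a b. ((\<lambda>x. B x a b) \<longlongrightarrow> B0 a b) F"
  shows "((\<lambda>x. tlift (B x) (r x)) \<longlongrightarrow> tlift B0 r0) F"
  unfolding tlift_def by (intro tendsto_intros tendsto_vec_scale assms)

lemma exp_eq_one_imp_zero:
  assumes "exp z = 1" "norm z < 2 * pi"
  shows "z = (0::complex)"
proof -
  obtain n :: int where n: "Re z = 0" "Im z = of_int (2 * n) * pi" using assms(1) by (auto simp: exp_eq_1)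
  have "\<bar>Im z\<bar> < 2 * pi" using abs_Im_le_cmod[of z] assms(2) by linarith
  then have "\<bar>of_int (2 * n)\<bar> * pi < 2 * pi" using n by (simp add: abs_mult)
  then have "\<bar>real_of_int (2 * n)\<bar> < 2" by simp
  then have "n = 0" by linarith
  then show ?thesis using n by (simp add: complex_eq_iff)
qed

text \<open>Covers \<open>x = y\<close> too, since the neighbourhood is punctured: the zeros of
  \<open>exp t - exp y\<close> are isolated, as this function does not vanish at
  \<open>y + 1\<close>.\<close>

lemma eventually_exp_neq: "\<forall>\<^sub>F t in at x. exp t \<noteq> exp (y::complex)"
proof -
  have "exp (y + 1) - exp y \<noteq> 0"
    using exp_eq_one_imp_zero[of 1] pi_gt3 by (auto simp: exp_add)
  then have "\<forall>\<^sub>F t in at x. exp t - exp y \<noteq> 0 \<and> t \<in> UNIV"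
    by (intro non_zero_neighbour_alt[where S = UNIV and \<beta> = "y + 1"]) (auto intro!: holomorphic_intros)
  then show ?thesis by eventually_elim auto
qed

lemma eventually_nhds_exp_neq: "exp x \<noteq> exp y \<Longrightarrow> \<forall>\<^sub>F t in nhds x. exp t \<noteq> exp (y::complex)"
  using t1_space_nhds[of "exp x" "exp y"] isCont_exp[of x]
  by (auto simp: continuous_at filterlim_iff eventually_nhds_conv_at)

lemma tendsto_tens2:
  fixes a b :: "'x \<Rightarrow> complex^'n"
  assumes "(a \<longlongrightarrow> a0) F" "(b \<longlongrightarrow> b0) F"
  shows "((\<lambda>x. tens2 (a x) (b x)) \<longlongrightarrow> tens2 a0 b0) F"
proof (rule vec_tendstoI)
  fix p :: "'n \<times> 'n"
  obtain i j where p: "p = (i, j)" by (cases p)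
  show "((\<lambda>x. tens2 (a x) (b x) $ p) \<longlongrightarrow> tens2 a0 b0 $ p) F"
    unfolding tens2_def p by (simp add: assms tendsto_mult tendsto_vec_nth)
qed

section \<open>Reduction to one spectral parameter\<close>

locale coxeter_solution = nondeg_lie br for br :: "complex^'n \<Rightarrow> complex^'n \<Rightarrow> complex^'n" +
  fixes \<sigma> :: "complex^'n \<Rightarrow> complex^'n" and m :: nat and \<gamma> :: "nat \<Rightarrow> 'n tensor2"
    and g r :: "complex \<times> complex \<Rightarrow> 'n tensor2"
  assumes order: "has_order \<sigma> m"
    and aut: "lie_automorphism br \<sigma>"
    and \<gamma>: "\<And>j. j < m \<Longrightarrow> \<gamma> j \<in> tensor_subspace (grading_part \<sigma> m (int j)) (grading_part \<sigma> m (- int j))"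
    and casimir_sum: "casimir br = (\<Sum>j<m. \<gamma> j)"
    and g_holomorphic: "tensor_holomorphic2_on g UNIV"
    and r_eq: "\<And>x y. x ^ m \<noteq> y ^ m \<Longrightarrow>
           r (x, y) = (y ^ m / (x ^ m - y ^ m)) *s (\<Sum>j<m. (x / y) ^ j *s \<gamma> j) + g (x, y)"
    and cybe: "cybe_two_variables br {(x, y). x ^ m \<noteq> y ^ m} r"
begin

lemma m_pos: "m > 0"
  using order by (simp add: has_order_def)

text \<open>The explicit part of \<open>r\<close> with \<open>exp z\<close> in place of
  \<open>(x / y) ^ m\<close>.\<close>

definition \<psi> :: "complex \<Rightarrow> 'n tensor2" where
  "\<psi> z = (1 / (exp z - 1)) *s (\<Sum>j<m. exp (z * of_nat j / of_nat m) *s \<gamma> j)"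

definition G :: "complex \<Rightarrow> complex \<Rightarrow> 'n tensor2" where
  "G u v = g (exp (u / of_nat m), exp (v / of_nat m))"

definition R :: "complex \<Rightarrow> complex \<Rightarrow> 'n tensor2" where
  "R u v = \<psi> (u - v) + G u v"

lemma exp_power_m: "exp (u / of_nat m) ^ m = exp (u :: complex)"
  using m_pos by (simp flip: exp_of_nat_mult)

lemma r_exp:
  assumes "exp u \<noteq> exp v"
  shows "r (exp (u / of_nat m), exp (v / of_nat m)) = R u v"
proof -
  have "exp v / (exp u - exp v) = 1 / (exp (u - v) - 1)"
    using assms by (simp add: exp_diff field_simps)
  moreover have "(exp (u / of_nat m) / exp (v / of_nat m)) ^ j = exp ((u - v) * of_nat j / of_nat m)" for j
    by (simp flip: exp_diff exp_of_nat_mult) (simp add: algebra_simps diff_divide_distrib)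
  ultimately show ?thesis
    using r_eq[of "exp (u / of_nat m)" "exp (v / of_nat m)"] assms
    by (simp add: exp_power_m R_def \<psi>_def G_def)
qed

lemma cybe_R:
  assumes "exp u1 \<noteq> exp u2" "exp u1 \<noteq> exp u3" "exp u2 \<noteq> exp u3"
  shows "br_12_13 br (R u1 u2) (R u1 u3) + br_13_23 br (R u1 u3) (R u2 u3) + br_12_23 br (R u1 u2) (R u2 u3) = 0"
  using cybe[unfolded cybe_two_variables_def, THEN conjunct1, rule_format,
      of "exp (u1 / of_nat m)" "exp (u2 / of_nat m)" "exp (u3 / of_nat m)"] assms
  by (simp add: exp_power_m r_exp)

lemma skew_R:
  assumes "exp u \<noteq> exp v"
  shows "R u v = - tens2_flip (R v u)"
  using cybe[unfolded cybe_two_variables_def, THEN conjunct2, rule_format,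
      of "exp (u / of_nat m)" "exp (v / of_nat m)"] assms assms[symmetric]
  by (simp add: exp_power_m r_exp)

lemma G_holomorphic2: "holomorphic2_on (\<lambda>z. G (fst z) (snd z) $ p) S"
proof -
  have "holomorphic2_on (\<lambda>z. g z $ p) UNIV" using g_holomorphic unfolding tensor_holomorphic2_on_def by blast
  then show ?thesis unfolding G_def
    by (intro holomorphic2_on_compose2[where F = "\<lambda>z. g z $ p" and T = UNIV]
        holomorphic2_on_compose[where f = "\<lambda>z. exp (z / of_nat m)" and T = UNIV]
        holomorphic2_on_fst holomorphic2_on_snd holomorphic_intros) auto
qed

lemma G_holomorphic:
  assumes "p holomorphic_on UNIV" "q holomorphic_on UNIV"
  shows "(\<lambda>t. G (p t) (q t) $ i) holomorphic_on UNIV"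
  using holomorphic2_on_curve[OF G_holomorphic2[of i UNIV] assms(1) open_UNIV assms(2)] by simp

lemma \<psi>_holomorphic: "(\<lambda>z. \<psi> z $ p) holomorphic_on {z. exp z \<noteq> 1}"
  unfolding \<psi>_def using m_pos by (auto intro!: holomorphic_intros simp: sum_distrib_left)

lemma open_exp_neq_1: "open {z::complex. exp z \<noteq> 1}"
  by (intro open_Collect_neq continuous_intros)

lemma R_holomorphic2: "holomorphic2_on (\<lambda>z. R (fst z) (snd z) $ p) {z. exp (fst z) \<noteq> exp (snd z)}"
  unfolding R_def vector_add_component
  by (intro holomorphic2_on_add G_holomorphic2 holomorphic2_on_diff holomorphic2_on_fst holomorphic2_on_snd
      holomorphic2_on_compose[where f = "\<lambda>z. \<psi> z $ p", OF _ \<psi>_holomorphic open_exp_neq_1])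
    (auto simp: exp_diff)

text \<open>Each coefficient \<open>exp (z * a) / (exp z - 1)\<close> has principal part
  \<open>1 / z\<close>, whatever \<open>a\<close> is, and the \<open>\<gamma> j\<close> add up to
  the Casimir element.\<close>

lemma \<psi>_principal_part:
  "\<exists>s. ((\<lambda>z. \<psi> z - (1 / z) *s casimir br) \<longlongrightarrow> s) (at 0)"
proof -
  have "\<exists>l. ((\<lambda>z. exp (z * a) / (exp z - 1) - 1 / z) \<longlongrightarrow> l) (at 0)" for a :: complex
  proof -
    \<comment> \<open>The entire extension of \<open>(exp z - 1) / z\<close>. It has no zero in the
      unit disc, so the required limit is the derivative of \<open>exp (z * a) / F z\<close> at
      \<open>0\<close>.\<close>
    define F where "F z = (if z = 0 then 1 else (exp z - 1) / z)" for z :: complex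
    have "((\<lambda>z. (exp z - 1) / z) \<longlongrightarrow> 1) (at (0::complex))"
      using DERIV_exp[of "0::complex"] by (simp add: has_field_derivative_iff)
    then have "F holomorphic_on UNIV"
      unfolding F_def
      by (intro removable_singularity holomorphic_intros) auto
    define S where "S = ball (0::complex) 1"
    have "F z \<noteq> 0" if "z \<in> S" for z
      using that exp_eq_one_imp_zero[of z] pi_ge_two by (auto simp: F_def S_def)
    then have "(\<lambda>z. exp (z * a) / F z) holomorphic_on S"
      using \<open>F holomorphic_on UNIV\<close> by (auto intro!: holomorphic_intros intro: holomorphic_on_subset)
    then obtain d where "((\<lambda>z. exp (z * a) / F z) has_field_derivative d) (at 0)"
      unfolding S_def by (meson centre_in_ball holomorphic_on_open open_ball zero_less_one)
    then have lim: "((\<lambda>z. (exp (z * a) / F z - 1) / z) \<longlongrightarrow> d) (at 0)"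
      by (simp add: has_field_derivative_iff F_def)
    have ev: "\<forall>\<^sub>F z in at 0. (exp (z * a) / F z - 1) / z = exp (z * a) / (exp z - 1) - 1 / z"
      using eventually_exp_neq[of 0 0] eventually_neq_at_within[of 0 0 UNIV]
      by eventually_elim (auto simp: F_def field_simps)
    show ?thesis by (rule exI) (rule Lim_transform_eventually[OF lim ev])
  qed
  then have "\<forall>a::complex. \<exists>l. ((\<lambda>z. exp (z * a) / (exp z - 1) - 1 / z) \<longlongrightarrow> l) (at 0)" by blast
  from choice[OF this] obtain l where l: "\<And>a::complex. ((\<lambda>z. exp (z * a) / (exp z - 1) - 1 / z) \<longlongrightarrow> l a) (at 0)"
    by blast
  have "\<psi> z - (1 / z) *s casimir br = (\<Sum>j<m. (exp (z * (of_nat j / of_nat m)) / (exp z - 1) - 1 / z) *s \<gamma> j)" for z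
    by (simp add: \<psi>_def casimir_sum vec.scale_sum_right vec.scale_left_diff_distrib sum_subtractf)
  moreover have "((\<lambda>z. \<Sum>j<m. (exp (z * (of_nat j / of_nat m)) / (exp z - 1) - 1 / z) *s \<gamma> j) \<longlongrightarrow>
      (\<Sum>j<m. l (of_nat j / of_nat m) *s \<gamma> j)) (at 0)"
    by (intro tendsto_sum tendsto_vec_scale l tendsto_const)
  ultimately show ?thesis by auto
qed

text \<open>The constant term of the Laurent expansion of \<open>\<psi>\<close> at
  \<open>0\<close>.\<close>

definition \<psi>0 :: "'n tensor2" where
  "\<psi>0 = (SOME s. ((\<lambda>z. \<psi> z - (1 / z) *s casimir br) \<longlongrightarrow> s) (at 0))"

lemma tendsto_\<psi>0: "((\<lambda>z. \<psi> z - (1 / z) *s casimir br) \<longlongrightarrow> \<psi>0) (at 0)"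
  unfolding \<psi>0_def by (rule someI_ex[OF \<psi>_principal_part])

text \<open>\<open>\<psi>0 + G u u\<close> is the limit of the regular part of \<open>R u t\<close>
  as \<open>t\<close> tends to \<open>u\<close>; by \<open>acts_left_right\<close> its two actions
  sum to \<open>br (f u)\<close>.\<close>

definition f :: "complex \<Rightarrow> complex^'n" where
  "f u = tlift br (\<psi>0 + G u u)"

lemma f_holomorphic: "(\<lambda>u. f u $ i) holomorphic_on UNIV"
  unfolding f_def tlift_def by (auto intro!: holomorphic_intros G_holomorphic simp: sum_distrib_left)

section \<open>Partial derivatives of the solution\<close>

lemma R_tendsto:
  assumes "exp u \<noteq> exp w"
  shows "((\<lambda>t. R t w) \<longlongrightarrow> R u w) (at u)"
proof (rule vec_tendstoI)
  fix p
  have "isCont (\<lambda>z. R (fst z) (snd z) $ p) (u, w)"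
    by (rule holomorphic2_on_isCont[OF R_holomorphic2]) (use assms in auto)
  moreover have "((\<lambda>t. (t, w)) \<longlongrightarrow> (u, w)) (at u)"
    by (intro tendsto_intros)
  ultimately show "((\<lambda>t. R t w $ p) \<longlongrightarrow> R u w $ p) (at u)"
    using isCont_tendsto_compose by fastforce
qed

lemma R_partial_1:
  assumes uw: "exp u \<noteq> exp w"
  shows "vec_deriv (\<lambda>t. R t w) (tens2_map (br (f u)) (\<lambda>x. x) (R u w) + tensor_square (R u w) (R u w)) u"
proof -
  define S where "S t = (\<psi> (u - t) - (1 / (u - t)) *s casimir br) + G u t" for t
  define S0 where "S0 = \<psi>0 + G u u"
  have "((\<lambda>t. G u t) \<longlongrightarrow> G u u) (at u)"
  proof (rule vec_tendstoI)
    fix p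
    have "(\<lambda>t. G u t $ p) holomorphic_on UNIV" by (rule G_holomorphic) (auto intro: holomorphic_intros)
    then have "continuous_on UNIV (\<lambda>t. G u t $ p)" by (rule holomorphic_on_imp_continuous_on)
    then show "((\<lambda>t. G u t $ p) \<longlongrightarrow> G u u $ p) (at u)" by (simp add: continuous_on_def)
  qed
  moreover have "filterlim (\<lambda>t. u - t) (at 0) (at u)"
    by (auto simp: filterlim_at eventually_at_filter intro!: tendsto_eq_intros)
  ultimately have S: "(S \<longlongrightarrow> S0) (at u)"
    unfolding S_def S0_def by (intro tendsto_add filterlim_compose[OF tendsto_\<psi>0])
  let ?rhs = "\<lambda>t. tens2_map (acts_left (S t)) (\<lambda>x. x) (R u w) + tens2_map (acts_right (S t)) (\<lambda>x. x) (R t w) +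
    tensor_square (R u w) (R t w)"
  \<comment> \<open>The equation at \<open>(u, t, w)\<close> requires pairwise distinct
    exponentials, which holds for all \<open>t \<noteq> u\<close> close to \<open>u\<close>.\<close>
  have ev: "\<forall>\<^sub>F t in at u. (1 / (t - u)) *s (R t w - R u w) = ?rhs t"
    using eventually_exp_neq[of u u] eventually_exp_neq[of w u]
  proof eventually_elim
    case (elim t)
    have "br_12_13 br (R u t) (R u w) + br_13_23 br (R u w) (R t w) + br_12_23 br (R u t) (R t w) = 0"
      using cybe_R[of u t w] elim uw by simp
    moreover have "R u t = (1 / (u - t)) *s casimir br + S t"
      by (simp add: R_def S_def)
    ultimately have "(1 / (u - t)) *s (R u w - R t w) = ?rhs t"
      by (rule contracted_cybe)
    moreover have "(1 / (u - t)) *s (R u w - R t w) = (1 / (t - u)) *s (R t w - R u w)"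
      by (simp add: vec_eq_iff divide_simps) (simp add: algebra_simps)
    ultimately show ?case by simp
  qed
  have lim: "(?rhs \<longlongrightarrow> tens2_map (acts_left S0) (\<lambda>x. x) (R u w) + tens2_map (acts_right S0) (\<lambda>x. x) (R u w) +
    tensor_square (R u w) (R u w)) (at u)"
    unfolding tens2_map_tlift tensor_square_def acts_left_def acts_right_def
    by (intro tendsto_add tendsto_tlift tendsto_tens2 R_tendsto[OF uw] S tendsto_const)
  have "tens2_map (acts_left S0) (\<lambda>x. x) (R u w) + tens2_map (acts_right S0) (\<lambda>x. x) (R u w) =
    tens2_map (br (f u)) (\<lambda>x. x) (R u w)"
    by (simp add: tens2_map_add_left[symmetric] acts_left_right f_def S0_def)
  with Lim_transform_eventually[OF lim] ev have "((\<lambda>t. (1 / (t - u)) *s (R t w - R u w)) \<longlongrightarrow>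
      tens2_map (br (f u)) (\<lambda>x. x) (R u w) + tensor_square (R u w) (R u w)) (at u)"
    by (simp add: eq_commute)
  then have lim': "((\<lambda>t. ((1 / (t - u)) *s (R t w - R u w)) $ p) \<longlongrightarrow>
      (tens2_map (br (f u)) (\<lambda>x. x) (R u w) + tensor_square (R u w) (R u w)) $ p) (at u)" for p
    by (rule tendsto_vec_nth)
  have eq: "((1 / (t - u)) *s (R t w - R u w)) $ p = (R t w $ p - R u w $ p) / (t - u)" for t p
    by (simp add: diff_divide_distrib)
  show ?thesis
    unfolding vec_deriv_def has_field_derivative_iff using lim' unfolding eq by blast
qed

text \<open>Skew-symmetry transports \<open>R_partial_1\<close>. The quadratic term does not change
  when both its arguments are negated, so the outer minus sign survives and makes it opposite to the
  one in \<open>R_partial_1\<close>.\<close>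

lemma R_partial_2:
  assumes uw: "exp u \<noteq> exp w"
  shows "vec_deriv (\<lambda>t. R u t) (tens2_map (\<lambda>x. x) (br (f w)) (R u w) - tensor_square (R u w) (R u w)) w"
proof -
  let ?D = "tens2_map (br (f w)) (\<lambda>x. x) (R w u) + tensor_square (R w u) (R w u)"
  have D: "vec_deriv (\<lambda>t. R t u) ?D w" using R_partial_1[of w u] uw by auto
  have flip: "tens2_flip (R w u) = - R u w" using skew_R[OF uw] by simp
  have "- tens2_flip ?D = tens2_map (\<lambda>x. x) (br (f w)) (R u w) - tensor_square (R u w) (R u w)"
    by (simp add: vec.linear_add[OF tens2_flip_linear] tens2_flip_map tens2_flip_tensor_square flip
        tensor_square_minus vec.linear_neg[OF tens2_map_linear])
  moreover have "vec_deriv (\<lambda>t. R u t) (- tens2_flip ?D) w"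
    unfolding vec_deriv_def
  proof
    fix p :: "'n \<times> 'n"
    obtain i j where p: "p = (i, j)" by (cases p)
    have "((\<lambda>t. - (R t u $ (j, i))) has_field_derivative - (?D $ (j, i))) (at w)"
      using D unfolding vec_deriv_def by (intro DERIV_minus) auto
    \<comment> \<open>Skew-symmetry is available only where the exponentials differ, but a
      derivative depends only on the values near \<open>w\<close>.\<close>
    moreover have "\<forall>\<^sub>F t in nhds w. R u t $ p = - (R t u $ (j, i))"
      using eventually_nhds_exp_neq[OF uw[symmetric]]
    proof eventually_elim
      case (elim t)
      then show ?case using skew_R[of u t] by (simp add: p tens2_flip_def)
    qed
    ultimately show "((\<lambda>t. R u t $ p) has_field_derivative (- tens2_flip ?D) $ p) (at w)"
      by (subst DERIV_cong_ev[OF refl _ refl]) (simp_all add: p tens2_flip_def)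
  qed
  ultimately show ?thesis by simp
qed

lemma R_diagonal:
  assumes z: "exp z \<noteq> 1"
  shows "vec_deriv (\<lambda>t. R (z + t) t)
    (tens2_map (br (f (z + t))) (\<lambda>x. x) (R (z + t) t) + tens2_map (\<lambda>x. x) (br (f t)) (R (z + t) t)) t"
  unfolding vec_deriv_def
proof
  fix p
  have ne: "exp (z + t) \<noteq> exp t" using z by (simp add: exp_add)
  let ?D1 = "tens2_map (br (f (z + t))) (\<lambda>x. x) (R (z + t) t) + tensor_square (R (z + t) t) (R (z + t) t)"
    and ?D2 = "tens2_map (\<lambda>x. x) (br (f t)) (R (z + t) t) - tensor_square (R (z + t) t) (R (z + t) t)"
  have "((\<lambda>x. R x t $ p) has_field_derivative ?D1 $ p) (at (z + t))"
    using R_partial_1[OF ne] unfolding vec_deriv_def by blast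
  moreover have "((\<lambda>x. R (z + t) x $ p) has_field_derivative ?D2 $ p) (at t)"
    using R_partial_2[OF ne] unfolding vec_deriv_def by blast
  moreover have "((\<lambda>t. z + t) has_field_derivative 1) (at t)" "((\<lambda>t. t) has_field_derivative 1) (at t)"
    by (auto intro!: derivative_eq_intros)
  ultimately have "((\<lambda>t. R (z + t) t $ p) has_field_derivative ?D1 $ p * 1 + ?D2 $ p * 1) (at t)"
    using holomorphic2_on_chain[OF R_holomorphic2[of p], of "\<lambda>t. z + t" t "\<lambda>t. t" 1 1 "?D1 $ p" "?D2 $ p"] ne
    by simp
  then show "((\<lambda>t. R (z + t) t $ p) has_field_derivative (tens2_map (br (f (z + t))) (\<lambda>x. x) (R (z + t) t) +
     tens2_map (\<lambda>x. x) (br (f t)) (R (z + t) t)) $ p) (at t)"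
    by simp
qed

text \<open>Along \<open>(z + t, t)\<close> the derivatives of the two gauge factors cancel both
  terms of \<open>R_diagonal\<close>, so the gauged function does not depend on
  \<open>t\<close>.\<close>

lemma gauge_constant:
  assumes \<Phi>: "\<And>z. mat_deriv \<Phi> (- (\<Phi> z ** matrix (br (f z)))) z" and uv: "exp u \<noteq> exp v"
  shows "tens2_map ((*v) (\<Phi> u)) ((*v) (\<Phi> v)) (R u v) = tens2_map ((*v) (\<Phi> (u - v))) ((*v) (\<Phi> 0)) (R (u - v) 0)"
proof -
  define z where "z = u - v"
  have z: "exp z \<noteq> 1" using uv by (simp add: z_def exp_diff)
  have mv_axis: "(M *v axis i 1) $ p = M $ p $ i" for M :: "complex^'n^'n" and i p
    by (simp add: matrix_vector_mult_def axis_def if_distrib[of "\<lambda>x. _ * x"] cong: if_cong)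
  have "vec_deriv (\<lambda>t. tens2_map ((*v) (\<Phi> (z + t))) ((*v) (\<Phi> t)) (R (z + t) t)) 0 t" for t
    unfolding vec_deriv_def
  proof
    fix pq :: "'n \<times> 'n"
    obtain p q where pq: "pq = (p, q)" by (cases pq)
    let ?X = "R (z + t) t"
    let ?A = "\<lambda>z. - (\<Phi> z ** matrix (br (f z)))"
    let ?X1 = "tens2_map (br (f (z + t))) (\<lambda>x. x) ?X" and ?X2 = "tens2_map (\<lambda>x. x) (br (f t)) ?X"
    \<comment> \<open>The left side is the shape in which \<open>DERIV_mult\<close> yields the
      product rule; the right side sorts it by the factor that was differentiated.\<close>
    have expand: "(\<Sum>i\<in>UNIV. \<Sum>j\<in>UNIV. Y $ (i, j) * (M $ p $ i * N $ q $ j) +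
          (M' $ p $ i * N $ q $ j + N' $ q $ j * M $ p $ i) * X $ (i, j)) =
       (tens2_map ((*v) M) ((*v) N) Y + tens2_map ((*v) M') ((*v) N) X + tens2_map ((*v) M) ((*v) N') X) $ pq"
      for X Y :: "'n tensor2" and M N M' N' :: "complex^'n^'n"
      by (simp add: pq tens2_map_nth mv_axis sum.distrib[symmetric]) (simp add: algebra_simps)
    have R': "((\<lambda>t. R (z + t) t $ ij) has_field_derivative (?X1 + ?X2) $ ij) (at t)" for ij
      using R_diagonal[OF z] unfolding vec_deriv_def by blast
    have \<Phi>': "((\<lambda>t. \<Phi> (z + t) $ i $ j) has_field_derivative ?A (z + t) $ i $ j) (at t)" for i j
      using \<Phi>[of "z + t"] DERIV_shift[of "\<lambda>s. \<Phi> s $ i $ j" "?A (z + t) $ i $ j" t z]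
      by (simp add: mat_deriv_def add.commute[of t z] add.commute[of _ z])
    have \<Phi>'': "((\<lambda>t. \<Phi> t $ i $ j) has_field_derivative ?A t $ i $ j) (at t)" for i j
      using \<Phi>[of t] by (simp add: mat_deriv_def)
    have "((\<lambda>t. \<Sum>i\<in>UNIV. \<Sum>j\<in>UNIV. R (z + t) t $ (i, j) * (\<Phi> (z + t) $ p $ i * \<Phi> t $ q $ j)) has_field_derivative
       (\<Sum>i\<in>UNIV. \<Sum>j\<in>UNIV. (?X1 + ?X2) $ (i, j) * (\<Phi> (z + t) $ p $ i * \<Phi> t $ q $ j) +
          (?A (z + t) $ p $ i * \<Phi> t $ q $ j + ?A t $ q $ j * \<Phi> (z + t) $ p $ i) * ?X $ (i, j))) (at t)"
      by (intro DERIV_sum DERIV_mult R' \<Phi>' \<Phi>'')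
    also have "(\<lambda>t. \<Sum>i\<in>UNIV. \<Sum>j\<in>UNIV. R (z + t) t $ (i, j) * (\<Phi> (z + t) $ p $ i * \<Phi> t $ q $ j)) =
       (\<lambda>t. tens2_map ((*v) (\<Phi> (z + t))) ((*v) (\<Phi> t)) (R (z + t) t) $ pq)"
      by (simp add: pq tens2_map_nth mv_axis)
    also have "(\<Sum>i\<in>UNIV. \<Sum>j\<in>UNIV. (?X1 + ?X2) $ (i, j) * (\<Phi> (z + t) $ p $ i * \<Phi> t $ q $ j) +
          (?A (z + t) $ p $ i * \<Phi> t $ q $ j + ?A t $ q $ j * \<Phi> (z + t) $ p $ i) * ?X $ (i, j)) =
       (tens2_map ((*v) (\<Phi> (z + t))) ((*v) (\<Phi> t)) (?X1 + ?X2) +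
        tens2_map ((*v) (?A (z + t))) ((*v) (\<Phi> t)) ?X + tens2_map ((*v) (\<Phi> (z + t))) ((*v) (?A t)) ?X) $ pq"
      by (rule expand)
    also have "\<dots> = 0"
    proof -
      have A: "((*v) (?A z)) = (\<lambda>a. (-1) *s (\<Phi> z *v br (f z) a))" for z
      proof
        fix a
        have "(- X) *v a = (-1) *s (X *v a)" for X :: "complex^'n^'n"
          by (simp add: matrix_vector_mult_def vec_eq_iff sum_negf)
        then show "?A z *v a = (-1) *s (\<Phi> z *v br (f z) a)"
          by (simp only: matrix_vector_mul_assoc[symmetric] ad_works)
      qed
      have *: "tens2_map ((*v) (?A (z + t))) ((*v) (\<Phi> t)) ?X = - tens2_map (\<lambda>a. \<Phi> (z + t) *v br (f (z + t)) a) ((*v) (\<Phi> t)) ?X"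
        unfolding A tens2_map_scale_left by simp
      have neg: "tens2_map h (\<lambda>a. (-1) *s k a) ?X = - tens2_map h k ?X" for h k
        by (simp only: tens2_map_tlift tens2_scale_right tlift_scale_fun) simp
      have **: "tens2_map ((*v) (\<Phi> (z + t))) ((*v) (?A t)) ?X = - tens2_map ((*v) (\<Phi> (z + t))) (\<lambda>a. \<Phi> t *v br (f t) a) ?X"
        unfolding A by (rule neg)
      show ?thesis
        unfolding vec.linear_add[OF tens2_map_linear] * **
        by (simp add: tens2_map_comp)
    qed
    finally show "((\<lambda>t. tens2_map ((*v) (\<Phi> (z + t))) ((*v) (\<Phi> t)) (R (z + t) t) $ pq) has_field_derivative 0 $ pq) (at t)"
      by simp
  qed
  \<comment> \<open>Comparison of \<open>t = v\<close>, where \<open>z + t = u\<close>, with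
    \<open>t = 0\<close>.\<close>
  from vec_deriv_zero_constant[OF this, of v] show ?thesis by (simp add: z_def)
qed

end

section \<open>The trigonometric solution\<close>

lemma tens2_map_eq_0_imp:
  assumes F: "clinear F" "inj F" and H: "clinear H" "inj H" and 0: "tens2_map F H X = 0"
  shows "X = 0"
proof -
  obtain F' where F': "clinear F'" "F' \<circ> F = id" using vec.linear_injective_left_inverse[OF F] by blast
  obtain H' where H': "clinear H'" "H' \<circ> H = id" using vec.linear_injective_left_inverse[OF H] by blast
  have "X = tens2_map F' H' (tens2_map F H X)"
    using F'(2) H'(2) by (simp add: tens2_map_comp[OF F'(1) H'(1)] fun_eq_iff tens2_map_ident)
  also have "\<dots> = 0" unfolding 0 by (rule vec.linear_0[OF tens2_map_linear])
  finally show ?thesis .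
qed

lemma clinear_funpow:
  fixes \<sigma> :: "complex^'n \<Rightarrow> complex^'n"
  assumes \<sigma>: "clinear \<sigma>"
  shows "clinear (\<sigma> ^^ n)"
proof (induction n)
  case 0 then show ?case by (simp add: vec.linear_ident)
next
  case (Suc n) then show ?case using Vector_Spaces.linear_compose[OF Suc \<sigma>] by (simp add: o_def)
qed

text \<open>Acting on the first leg alone multiplies \<open>\<gamma> j\<close> by a power of a root
  of unity; this matches the values of the exponential coefficients of \<open>\<psi>\<close> at
  \<open>2 \<pi> \<i> k\<close>.\<close>

lemma tens2_map_funpow_graded:
  assumes \<sigma>: "clinear \<sigma>" and T: "T \<in> tensor_subspace (grading_part \<sigma> m j) B"
  shows "tens2_map (\<sigma> ^^ n) (\<lambda>x. x) T = exp (2 * pi * \<i> * of_int j / of_nat m) ^ n *s T"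
proof -
  have lin: "clinear (\<sigma> ^^ n)" by (rule clinear_funpow[OF \<sigma>])
  have pow: "(\<sigma> ^^ n) a = exp (2 * pi * \<i> * of_int j / of_nat m) ^ n *s a" if "a \<in> grading_part \<sigma> m j" for a n
  proof (induction n)
    case (Suc n)
    have "\<sigma> a = exp (2 * pi * \<i> * of_int j / of_nat m) *s a" using that by (simp add: grading_part_def)
    with Suc show ?case by (simp add: vec.linear_scale[OF \<sigma>] mult.commute)
  qed simp
  show ?thesis
    using T unfolding tensor_subspace_def
  proof (induction rule: vec.span_induct_alt)
    case base
    then show ?case by (simp add: vec.linear_0[OF tens2_map_linear])
  next
    case (step c x y)
    then obtain a b where x: "x = tens2 a b" "a \<in> grading_part \<sigma> m j" by blast
    have "tens2_map (\<sigma> ^^ n) (\<lambda>x. x) x = exp (2 * pi * \<i> * of_int j / of_nat m) ^ n *s x"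
      unfolding x(1) tens2_map_tens2[OF lin vec.linear_ident] pow[OF x(2)] by (rule tens2_scale_left)
    then show ?case
      using step(2) by (simp add: vec.linear_add[OF tens2_map_linear] vec.linear_scale[OF tens2_map_linear]
          vec.scale_right_distrib mult.commute)
  qed
qed

lemma exp_eq_1_iff_int: "exp z = 1 \<longleftrightarrow> (\<exists>k::int. z = of_int k * (2 * pi * \<i>))"
  unfolding exp_eq_1 by (auto simp: complex_eq_iff)

lemma subgroup_exp_eq_1: "subgroup_of_rank {z. exp z = 1} 1"
  unfolding subgroup_of_rank_def
proof (intro exI[of _ "{2 * pi * \<i>}"] conjI allI impI)
  show "{z. exp z = 1} = range (\<lambda>c :: complex \<Rightarrow> int. \<Sum>b\<in>{2 * pi * \<i>}. of_int (c b) * b)"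
  proof (intro equalityI subsetI)
    fix z :: complex assume "z \<in> {z. exp z = 1}"
    then obtain k :: int where k: "z = of_int k * (2 * pi * \<i>)" by (auto simp: exp_eq_1_iff_int)
    show "z \<in> range (\<lambda>c :: complex \<Rightarrow> int. \<Sum>b\<in>{2 * pi * \<i>}. of_int (c b) * b)"
      by (rule image_eqI[of _ _ "\<lambda>_. k"]) (simp_all add: k)
  qed (auto simp: exp_eq_1_iff_int)
qed auto

locale gauged_coxeter_solution = coxeter_solution br \<sigma> m \<gamma> g r
  for br :: "complex^'n \<Rightarrow> complex^'n \<Rightarrow> complex^'n" and \<sigma> m \<gamma> g r +
  fixes \<Phi> :: "complex \<Rightarrow> complex^'n^'n"
  assumes \<Phi>_0: "\<Phi> 0 = mat 1"
    and \<Phi>_deriv: "\<And>z. mat_deriv \<Phi> (- (\<Phi> z ** matrix (br (f z)))) z"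
    and \<Phi>_aut: "\<And>z. lie_automorphism br ((*v) (\<Phi> z))"
begin

text \<open>The gauged solution at \<open>v = 0\<close>. It is given by a formula on the whole
  plane, so it can also serve as its own meromorphic extension.\<close>

definition \<rho> :: "complex \<Rightarrow> 'n tensor2" where
  "\<rho> z = tens2_map ((*v) (\<Phi> z)) ((*v) (\<Phi> 0)) (R z 0)"

lemma \<rho>_diff: "exp u \<noteq> exp v \<Longrightarrow> \<rho> (u - v) = tens2_map ((*v) (\<Phi> u)) ((*v) (\<Phi> v)) (R u v)"
  unfolding \<rho>_def by (rule gauge_constant[OF \<Phi>_deriv, symmetric])

lemma \<Phi>_holomorphic: "(\<lambda>z. \<Phi> z $ i $ j) holomorphic_on UNIV"
  using \<Phi>_deriv unfolding mat_deriv_def holomorphic_on_open[OF open_UNIV] by blast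

lemma \<Phi>_vec_holomorphic: "(\<lambda>z. (\<Phi> z *v a) $ i) holomorphic_on UNIV"
  by (auto simp: matrix_vector_mult_def intro!: holomorphic_intros \<Phi>_holomorphic)

text \<open>The two-variable equation at the points \<open>x + y\<close>, \<open>y\<close>,
  \<open>0\<close>, whose differences are \<open>x\<close>, \<open>x + y\<close> and
  \<open>y\<close>.\<close>

lemma cybe_\<rho>:
  assumes "exp x \<noteq> 1" "exp y \<noteq> 1" "exp (x + y) \<noteq> 1"
  shows "br_12_13 br (\<rho> x) (\<rho> (x + y)) + br_12_23 br (\<rho> x) (\<rho> y) + br_13_23 br (\<rho> (x + y)) (\<rho> y) = 0"
proof -
  have ne: "exp (x + y) \<noteq> exp y" "exp (x + y) \<noteq> exp 0" "exp y \<noteq> exp 0"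
    using assms by (auto simp: exp_add)
  let ?F = "tens3_map ((*v) (\<Phi> (x + y))) ((*v) (\<Phi> y)) ((*v) (\<Phi> 0))"
  have "br_12_13 br (\<rho> x) (\<rho> (x + y)) + br_12_23 br (\<rho> x) (\<rho> y) + br_13_23 br (\<rho> (x + y)) (\<rho> y) =
    ?F (br_12_13 br (R (x + y) y) (R (x + y) 0)) + ?F (br_12_23 br (R (x + y) y) (R y 0)) +
    ?F (br_13_23 br (R (x + y) 0) (R y 0))"
    using \<rho>_diff[OF ne(1)] \<rho>_diff[OF ne(2)] \<rho>_diff[OF ne(3)]
    by (simp add: tens3_map_br_12_13 tens3_map_br_12_23 tens3_map_br_13_23 \<Phi>_aut)
  also have "\<dots> = ?F (br_12_13 br (R (x + y) y) (R (x + y) 0) + br_13_23 br (R (x + y) 0) (R y 0) +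
      br_12_23 br (R (x + y) y) (R y 0))"
    by (simp add: vec.linear_add[OF tens3_map_linear])
  also have "\<dots> = 0"
    unfolding cybe_R[OF ne] by (rule vec.linear_0[OF tens3_map_linear])
  finally show ?thesis .
qed

lemma \<rho>_nth: "\<rho> z $ (p, q) = (\<Sum>i\<in>UNIV. \<Sum>j\<in>UNIV. R z 0 $ (i, j) * ((\<Phi> z *v axis i 1) $ p * (\<Phi> 0 *v axis j 1) $ q))"
  by (simp add: \<rho>_def tens2_map_nth)

lemma G_0_holomorphic: "(\<lambda>z. G z 0 $ p) holomorphic_on UNIV"
  by (rule G_holomorphic) (auto intro: holomorphic_intros)

lemma \<rho>_meromorphic: "tensor_meromorphic_on \<rho> UNIV"
  unfolding tensor_meromorphic_on_def
proof
  fix pq :: "'n \<times> 'n"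
  obtain p q where pq: "pq = (p, q)" by (cases pq)
  have entire: "F meromorphic_on UNIV" if "F holomorphic_on UNIV" for F
    using that by (intro analytic_on_imp_meromorphic_on) (simp add: analytic_on_open)
  have R: "(\<lambda>z. R z 0 $ ij) meromorphic_on UNIV" for ij
    unfolding R_def \<psi>_def vector_add_component vector_smult_component sum_component diff_zero
    by (intro meromorphic_intros entire[OF G_0_holomorphic])
      (rule entire; use m_pos in \<open>auto intro!: holomorphic_intros\<close>)+
  show "(\<lambda>z. \<rho> z $ pq) meromorphic_on UNIV"
    unfolding pq \<rho>_nth by (intro meromorphic_intros R entire[OF \<Phi>_vec_holomorphic])
qed

lemma \<rho>_holomorphic: "(\<lambda>z. \<rho> z $ p) holomorphic_on {z. exp z \<noteq> 1}"
proof -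
  obtain a b where p: "p = (a, b)" by (cases p)
  have "(\<lambda>z. R z 0 $ ij) holomorphic_on {z. exp z \<noteq> 1}" for ij
    unfolding R_def vector_add_component diff_zero
    by (intro holomorphic_on_add \<psi>_holomorphic holomorphic_on_subset[OF G_0_holomorphic] subset_UNIV)
  then show ?thesis
    unfolding p \<rho>_nth
    by (intro holomorphic_intros holomorphic_on_subset[OF \<Phi>_vec_holomorphic] subset_UNIV)
qed

text \<open>The numerator of \<open>\<psi>\<close>; where \<open>exp z = 1\<close>, it is the
  residue of \<open>\<psi>\<close>.\<close>

definition twisted_casimir :: "complex \<Rightarrow> 'n tensor2" where
  "twisted_casimir z = (\<Sum>j<m. exp (z * of_nat j / of_nat m) *s \<gamma> j)"

text \<open>At \<open>z = 2 \<pi> \<i> k\<close> it is the Casimir element with a power of the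
  bijection \<open>\<sigma>\<close> applied to the first leg, and the Casimir element is
  nonzero.\<close>

lemma twisted_casimir_nonzero:
  assumes z: "exp z = 1"
  shows "twisted_casimir z \<noteq> 0"
proof
  assume 0: "twisted_casimir z = 0"
  obtain k :: int where k: "z = of_int k * (2 * pi * \<i>)" using z by (auto simp: exp_eq_1_iff_int)
  \<comment> \<open>The integer \<open>k\<close> may be negative; reducing it modulo
    \<open>m\<close> gives an exponent for \<open>funpow\<close> and changes the exponentials only
    by factors \<open>exp (2 \<pi> \<i> l j) = 1\<close>.\<close>
  define n where "n = nat (k mod int m)"
  define l where "l = k div int m"
  have "int n = k mod int m" using m_pos by (simp add: n_def)
  then have kn: "k = int n + int m * l" by (simp add: l_def)
  have exp_z: "exp (z * of_nat j / of_nat m) = exp (2 * pi * \<i> * of_int (int j) / of_nat m) ^ n" for j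
  proof -
    have "z * of_nat j / of_nat m = of_nat n * (2 * pi * \<i> * of_int (int j) / of_nat m) + of_int (l * int j) * (2 * pi * \<i>)"
      using m_pos by (simp add: k kn field_simps)
    moreover have "exp (of_int (l * int j) * (2 * pi * \<i>)) = 1"
      unfolding exp_eq_1_iff_int by blast
    ultimately show ?thesis by (simp only: exp_add exp_of_nat_mult mult_1_right)
  qed
  have \<sigma>: "clinear \<sigma>" "bij \<sigma>" using aut by (auto simp: lie_automorphism_def)
  have lin: "clinear (\<sigma> ^^ n)" by (rule clinear_funpow[OF \<sigma>(1)])
  have "twisted_casimir z = tens2_map (\<sigma> ^^ n) (\<lambda>x. x) (casimir br)"
    unfolding casimir_sum twisted_casimir_def vec.linear_sum[OF tens2_map_linear]
    using tens2_map_funpow_graded[OF \<sigma>(1) \<gamma>] exp_z by (intro sum.cong) auto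
  with 0 have "casimir br = 0"
    using tens2_map_eq_0_imp[OF lin bij_is_inj[OF bij_fn[OF \<sigma>(2)]] vec.linear_ident inj_on_id2] by metis
  then have "killing_map br 0 (axis i 1) = axis i 1" for i
    using killing_map_casimir by metis
  moreover have "killing_map br 0 x = 0" for x by (simp add: killing_map_def)
  ultimately have "axis i (1::complex) = 0" for i :: 'n by metis
  then show False by (simp add: axis_eq_0_iff)
qed

text \<open>The zeros of \<open>exp t - 1\<close> are simple with derivative \<open>1\<close>, and
  the entire functions \<open>G\<close> and \<open>\<Phi>\<close> contribute no pole.\<close>

lemma \<rho>_residue:
  assumes z: "exp z = 1"
  shows "((\<lambda>t. (t - z) *s \<rho> t) \<longlongrightarrow> tens2_map ((*v) (\<Phi> z)) ((*v) (\<Phi> 0)) (twisted_casimir z)) (at z)"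
proof -
  have cont: "((\<lambda>t. F t) \<longlongrightarrow> F z) (at z)" if "F holomorphic_on UNIV" for F :: "complex \<Rightarrow> complex"
    using holomorphic_on_imp_continuous_on[OF that] by (simp add: continuous_on_def)
  have "((\<lambda>t. (exp t - exp z) / (t - z)) \<longlongrightarrow> exp z) (at z)"
    using DERIV_exp[of z] by (simp add: has_field_derivative_iff)
  from tendsto_inverse[OF this] have 1: "((\<lambda>t. (t - z) / (exp t - 1)) \<longlongrightarrow> 1) (at z)"
    using z by simp
  have 2: "((\<lambda>t. t - z) \<longlongrightarrow> 0) (at z)" by (auto intro!: tendsto_eq_intros)
  have 3: "(twisted_casimir \<longlongrightarrow> twisted_casimir z) (at z)"
    unfolding twisted_casimir_def using m_pos by (intro tendsto_sum tendsto_vec_scale tendsto_intros) auto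
  have 4: "((\<lambda>t. G t 0) \<longlongrightarrow> G z 0) (at z)"
    by (rule vec_tendstoI) (rule cont[OF G_0_holomorphic])
  have "((\<lambda>t. ((t - z) / (exp t - 1)) *s twisted_casimir t + (t - z) *s G t 0) \<longlongrightarrow> 1 *s twisted_casimir z + 0 *s G z 0) (at z)"
    by (intro tendsto_add tendsto_vec_scale 1 2 3 4)
  moreover have "(t - z) *s R t 0 = ((t - z) / (exp t - 1)) *s twisted_casimir t + (t - z) *s G t 0" for t
    by (simp add: R_def \<psi>_def twisted_casimir_def vec.scale_right_distrib)
  ultimately have R: "((\<lambda>t. (t - z) *s R t 0) \<longlongrightarrow> twisted_casimir z) (at z)" by simp
  have \<Phi>: "((\<lambda>t. \<Phi> t *v a) \<longlongrightarrow> \<Phi> z *v a) (at z)" for a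
    by (rule vec_tendstoI) (rule cont[OF \<Phi>_vec_holomorphic])
  have "(t - z) *s \<rho> t = tens2_map ((*v) (\<Phi> t)) ((*v) (\<Phi> 0)) ((t - z) *s R t 0)" for t
    by (simp only: \<rho>_def vec.linear_scale[OF tens2_map_linear])
  then show ?thesis
    unfolding tens2_map_tlift by (simp only:) (intro tendsto_tlift R tendsto_tens2 \<Phi> tendsto_const)
qed

lemma \<rho>_poles: "tensor_poles \<rho> = {z. exp z = 1}"
proof (intro equalityI subsetI)
  fix z assume "z \<in> tensor_poles \<rho>"
  then obtain p where "is_pole (\<lambda>z. \<rho> z $ p) z" by (auto simp: tensor_poles_def)
  then have "z \<notin> {z. exp z \<noteq> 1}"
    using not_is_pole_holomorphic[OF open_exp_neq_1 _ \<rho>_holomorphic] by blast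
  then show "z \<in> {z. exp z = 1}" by simp
next
  fix z :: complex assume "z \<in> {z. exp z = 1}"
  then have z: "exp z = 1" by simp
  let ?T = "tens2_map ((*v) (\<Phi> z)) ((*v) (\<Phi> 0)) (twisted_casimir z)"
  have "clinear ((*v) (\<Phi> z))" "inj ((*v) (\<Phi> z))" for z
    using \<Phi>_aut by (auto simp: lie_automorphism_def bij_is_inj)
  then have "?T \<noteq> 0" using tens2_map_eq_0_imp twisted_casimir_nonzero[OF z] by blast
  \<comment> \<open>Poles are defined through coordinates, so one nonzero coordinate of the residue
    is enough.\<close>
  then obtain p where p: "?T $ p \<noteq> 0" by (metis vec_eq_iff zero_index)
  have "((\<lambda>t. ((t - z) *s \<rho> t) $ p) \<longlongrightarrow> ?T $ p) (at z)"
    by (rule tendsto_vec_nth[OF \<rho>_residue[OF z]])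
  moreover have "filterlim (\<lambda>t. t - z) (at 0) (at z)"
    by (auto simp: filterlim_at eventually_at_filter intro!: tendsto_eq_intros)
  ultimately have lim: "filterlim (\<lambda>t. ((t - z) *s \<rho> t) $ p / (t - z)) at_infinity (at z)"
    using p by (rule filterlim_divide_at_infinity)
  have ev: "\<forall>\<^sub>F t in at z. ((t - z) *s \<rho> t) $ p / (t - z) = \<rho> t $ p"
    unfolding eventually_at_filter vector_smult_component by simp
  have "is_pole (\<lambda>t. \<rho> t $ p) z"
    unfolding is_pole_def using lim filterlim_cong[OF refl refl ev] by blast
  then show "z \<in> tensor_poles \<rho>" unfolding tensor_poles_def by blast
qed

lemma killing_map_linear: "clinear (killing_map br T)"
  by (rule clinearI)
    (simp_all add: killing_map_def killing_add killing_scale sum.distrib vec.scale_sum_right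
      distrib_left vec.scale_left_distrib mult.left_commute)

text \<open>As \<open>t\<close> tends to \<open>0\<close>, \<open>t *s \<rho> t\<close> tends to the
  Casimir element, whose associated map is the identity; by continuity the determinant stays nonzero
  nearby.\<close>

lemma \<rho>_nondegenerate: "nondegenerate br \<rho>"
proof -
  define M where "M T = matrix (killing_map br T)" for T
  have M_tendsto: "((\<lambda>t. M (T t) $ i $ k) \<longlongrightarrow> M T0 $ i $ k) F" if "(T \<longlongrightarrow> T0) F" for T T0 F i k
  proof -
    have "M T $ i $ k = tlift (\<lambda>a b. killing br b (axis k 1) *s a) T $ i" for T
      by (simp add: M_def matrix_def killing_map_def tlift_def)
    then show ?thesis by (simp only:) (intro tendsto_vec_nth tendsto_tlift that tendsto_const)
  qed
  have id: "(*v) (mat 1) = (\<lambda>x :: complex^'n. x)" by (simp add: fun_eq_iff)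
  have "twisted_casimir 0 = casimir br" by (simp add: twisted_casimir_def casimir_sum)
  then have "((\<lambda>t. t *s \<rho> t) \<longlongrightarrow> casimir br) (at 0)"
    using \<rho>_residue[of 0] by (simp add: \<Phi>_0 id tens2_map_ident)
  then have "((\<lambda>t. det (M (t *s \<rho> t))) \<longlongrightarrow> det (M (casimir br))) (at 0)"
    unfolding det_def by (intro tendsto_sum tendsto_mult tendsto_prod tendsto_const M_tendsto)
  moreover have "M (casimir br) = mat 1"
    by (auto simp: M_def matrix_def killing_map_casimir mat_def axis_def vec_eq_iff)
  ultimately have "\<forall>\<^sub>F t in at 0. det (M (t *s \<rho> t)) \<noteq> 0"
    by (intro tendsto_imp_eventually_ne) auto
  then show ?thesis
    unfolding nondegenerate_def
  proof eventually_elim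
    case (elim t)
    then obtain M' where M': "M' ** M (t *s \<rho> t) = mat 1"
      by (auto simp: invertible_det_nz[symmetric] invertible_def)
    have "x = 0" if x: "killing_map br (\<rho> t) x = 0" for x
    proof -
      have "M (t *s \<rho> t) *v x = killing_map br (t *s \<rho> t) x"
        unfolding M_def by (rule matrix_works[OF killing_map_linear])
      also have "\<dots> = t *s killing_map br (\<rho> t) x"
        by (simp add: killing_map_def vec.scale_sum_right mult.assoc)
      finally have "M' *v (M (t *s \<rho> t) *v x) = 0" by (simp add: x)
      then show ?thesis by (simp add: matrix_vector_mul_assoc M')
    qed
    then have "inj (killing_map br (\<rho> t))"
      using vec.linear_inj_iff_eq_0[OF killing_map_linear] by blast
    then show ?case
      using vec.linear_inj_imp_surj[OF killing_map_linear] by (simp add: bij_def)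
  qed
qed

lemma \<rho>_trigonometric: "trigonometric_solution br \<rho>"
proof -
  have "cybe_one_parameter br \<rho>"
    unfolding cybe_one_parameter_def
  \<comment> \<open>Any radius up to \<open>2 \<pi>\<close> excludes the nonzero solutions of
    \<open>exp z = 1\<close>; \<open>1\<close> is convenient.\<close>
  proof (intro conjI exI[of _ "1::real"] allI impI)
    show "tensor_meromorphic_on \<rho> {0}"
      using \<rho>_meromorphic meromorphic_on_subset unfolding tensor_meromorphic_on_def by blast
    fix x y :: complex
    assume "x \<in> ball 0 1 - {0} \<and> y \<in> ball 0 1 - {0} \<and> x + y \<in> ball 0 1 - {0}"
    moreover have "exp z \<noteq> 1" if "z \<in> ball 0 1 - {0}" for z :: complex
      using that exp_eq_one_imp_zero[of z] pi_gt3 by auto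
    ultimately show "br_12_13 br (\<rho> x) (\<rho> (x + y)) + br_12_23 br (\<rho> x) (\<rho> y) + br_13_23 br (\<rho> (x + y)) (\<rho> y) = 0"
      by (intro cybe_\<rho>) auto
  qed simp
  then show ?thesis
    unfolding trigonometric_solution_def
    using \<rho>_nondegenerate \<rho>_meromorphic \<rho>_poles subgroup_exp_eq_1 by (auto intro!: exI[of _ \<rho>])
qed

section \<open>Equivalence with the given solution\<close>

lemma r_meromorphic: "meromorphic2_at r z"
proof -
  define q :: "complex \<times> complex \<Rightarrow> complex" where "q w = fst w ^ m - snd w ^ m" for w
  \<comment> \<open>Clearing denominators: \<open>y ^ m * (x / y) ^ j\<close> becomes the polynomial
    \<open>x ^ j * y ^ (m - j)\<close>. Since \<open>j < m\<close>, both vanish at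
    \<open>y = 0\<close>, which covers division by zero.\<close>
  define p where "p w = (\<Sum>j<m. (fst w ^ j * snd w ^ (m - j)) *s \<gamma> j) + q w *s g w" for w
  have q: "holomorphic2_on q UNIV"
    unfolding q_def by (intro holomorphic2_on_diff holomorphic2_on_power holomorphic2_on_fst holomorphic2_on_snd)
  have "holomorphic2_on (\<lambda>w. g w $ i) UNIV" for i
    using g_holomorphic unfolding tensor_holomorphic2_on_def by blast
  then have p: "tensor_holomorphic2_on p UNIV"
    unfolding tensor_holomorphic2_on_def p_def vector_add_component sum_component vector_smult_component
    by (intro allI holomorphic2_on_add holomorphic2_on_sum holomorphic2_on_mult holomorphic2_on_power
        holomorphic2_on_fst holomorphic2_on_snd holomorphic2_on_const q)
  have dense: "UNIV \<subseteq> closure {w \<in> UNIV. q w \<noteq> 0}"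
  proof (rule nonzero_dense)
    show "(\<lambda>x. q (x, y)) holomorphic_on UNIV" for y unfolding q_def by (auto intro!: holomorphic_intros)
    show "\<exists>x. q (x, y) \<noteq> 0" for y
    proof (cases "y = 0")
      case True
      then have "q (1, y) \<noteq> 0" using m_pos by (simp add: q_def power_0_left)
      then show ?thesis ..
    next
      case False
      then have "q (0, y) \<noteq> 0" using m_pos by (simp add: q_def power_0_left)
      then show ?thesis ..
    qed
  qed
  have "r w = (1 / q w) *s p w" if nz: "q w \<noteq> 0" for w
  proof -
    obtain x y where w: "w = (x, y)" by (cases w)
    have "y ^ m / (x ^ m - y ^ m) * (x / y) ^ j = (1 / q w) * (x ^ j * y ^ (m - j))" if "j < m" for j
    proof (cases "y = 0")
      case False
      have "y ^ m = y ^ j * y ^ (m - j)" using that by (simp flip: power_add)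
      with False show ?thesis by (simp add: q_def w power_divide)
    qed (use that in \<open>simp add: q_def w power_0_left\<close>)
    then have "(y ^ m / (x ^ m - y ^ m)) *s (\<Sum>j<m. (x / y) ^ j *s \<gamma> j) = (1 / q w) *s (\<Sum>j<m. (x ^ j * y ^ (m - j)) *s \<gamma> j)"
      by (auto simp: vec.scale_sum_right intro!: sum.cong)
    moreover have "x ^ m \<noteq> y ^ m" using nz by (simp add: q_def w)
    ultimately show ?thesis
      using r_eq[of x y] nz by (simp add: p_def w vec.scale_right_distrib)
  qed
  then show ?thesis
    unfolding meromorphic2_at_def using p q dense by blast
qed

text \<open>Two steps suffice: the exponential change of variables leads to \<open>s\<close>, which
  agrees with \<open>R\<close> off the zeros of \<open>q\<close>, and the gauge by
  \<open>\<Phi>\<close> leads to \<open>\<rho>\<close>.\<close>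

lemma r_equiv_\<rho>: "solution_equiv br (r, 0) (\<lambda>(u, v). \<rho> (u - v), 0)"
proof -
  define s where "s = (\<lambda>(u, v). r (exp (u / of_nat m), exp (v / of_nat m)))"
  define q :: "complex \<times> complex \<Rightarrow> complex" where "q w = exp (fst w) - exp (snd w)" for w
  define p where "p w = (\<Sum>j<m. (exp (snd w) * exp ((fst w - snd w) * (of_nat j / of_nat m))) *s \<gamma> j) + q w *s G (fst w) (snd w)" for w
  have exp2: "holomorphic2_on (\<lambda>w. exp (h w)) UNIV" if "holomorphic2_on h UNIV" for h
    by (rule holomorphic2_on_compose[OF that, of exp UNIV]) (auto intro: holomorphic_intros)
  have q: "holomorphic2_on q UNIV"
    unfolding q_def by (intro holomorphic2_on_diff exp2 holomorphic2_on_fst holomorphic2_on_snd)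
  have p: "tensor_holomorphic2_on p UNIV"
    unfolding tensor_holomorphic2_on_def p_def vector_add_component sum_component vector_smult_component
    by (intro allI holomorphic2_on_add holomorphic2_on_sum holomorphic2_on_mult exp2 holomorphic2_on_diff
        holomorphic2_on_fst holomorphic2_on_snd holomorphic2_on_const q G_holomorphic2)
  have dense: "UNIV \<subseteq> closure {w \<in> UNIV. q w \<noteq> 0}"
  proof (rule nonzero_dense)
    show "(\<lambda>x. q (x, y)) holomorphic_on UNIV" for y unfolding q_def by (auto intro!: holomorphic_intros)
    show "\<exists>x. q (x, y) \<noteq> 0" for y
      using exp_eq_one_imp_zero[of 1] pi_gt3 by (intro exI[of _ "y + 1"]) (auto simp: q_def exp_add)
  qed
  have s_eq: "s w = R (fst w) (snd w)" if "q w \<noteq> 0" for w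
    using that r_exp by (simp add: s_def q_def case_prod_beta)
  have "s w = (1 / q w) *s p w" if nz: "q w \<noteq> 0" for w
  proof -
    have "1 / (exp (fst w - snd w) - 1) = exp (snd w) / q w"
      using nz by (simp add: q_def exp_diff field_simps)
    then have "\<psi> (fst w - snd w) = (1 / q w) *s (\<Sum>j<m. (exp (snd w) * exp ((fst w - snd w) * (of_nat j / of_nat m))) *s \<gamma> j)"
      by (simp add: \<psi>_def vec.scale_sum_right)
    then show ?thesis
      using nz by (simp add: s_eq R_def p_def vec.scale_right_distrib)
  qed
  then have s_mero: "meromorphic2_at s (0, 0)"
    unfolding meromorphic2_at_def using p q dense by blast
  have "equiv_step br (r, 0) (s, 0)"
  \<comment> \<open>The base point moves from \<open>0\<close> to \<open>exp 0 = 1\<close>;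
    \<open>W = UNIV\<close> joins them, as \<open>r\<close> is meromorphic at every point.\<close>
  proof (rule change_of_variables[where W = UNIV and \<eta> = "\<lambda>u. exp (u / of_nat m)"])
    show "(\<lambda>u. exp (u / of_nat m)) analytic_on {0}"
      using m_pos by (auto intro!: analytic_intros)
    show "\<not> (\<forall>\<^sub>F u in nhds 0. exp (u / of_nat m) = exp (0 / of_nat m :: complex))"
    proof
      assume "\<forall>\<^sub>F u in nhds 0. exp (u / of_nat m) = exp (0 / of_nat m :: complex)"
      then have "\<forall>\<^sub>F u in at 0. exp (u / of_nat m) = exp (0 / of_nat m :: complex)"
        unfolding eventually_at_filter by (rule eventually_mono) simp
      then have "\<forall>\<^sub>F u :: complex in at 0. False"
        using eventually_exp_neq[of 0 0]
      proof eventually_elim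
        case (elim u)
        have "exp u = exp (u / of_nat m) ^ m" by (rule exp_power_m[symmetric])
        then show ?case using elim by simp
      qed
      then show False by simp
    qed
    show "generically_near (0, 0) (\<lambda>(u, v). s (u, v) = r (exp (u / of_nat m), exp (v / of_nat m)))"
      unfolding generically_near_def
      by (intro exI[of _ UNIV] exI[of _ "\<lambda>_. 1"]) (auto simp: s_def holomorphic2_on_const)
  qed (auto simp: r_meromorphic)
  moreover have "equiv_step br (s, 0) (\<lambda>(u, v). \<rho> (u - v), 0)"
  proof (rule gauge[where U = UNIV and \<phi> = "\<lambda>z. (*v) (\<Phi> z)"])
    show "generically_near (0, 0) (\<lambda>(x, y). (case (x, y) of (u, v) \<Rightarrow> \<rho> (u - v)) = tens2_map ((*v) (\<Phi> x)) ((*v) (\<Phi> y)) (s (x, y)))"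
      unfolding generically_near_def
    proof (intro exI[of _ UNIV] exI[of _ q] conjI ballI impI)
      \<comment> \<open>Off the zeros of \<open>q\<close> the exponentials differ, which is the
        hypothesis of \<open>\<rho>_diff\<close>.\<close>
      fix w assume nz: "q w \<noteq> 0"
      obtain x y where w: "w = (x, y)" by (cases w)
      show "case w of (x, y) \<Rightarrow> (case (x, y) of (u, v) \<Rightarrow> \<rho> (u - v)) = tens2_map ((*v) (\<Phi> x)) ((*v) (\<Phi> y)) (s (x, y))"
        using s_eq[OF nz] \<rho>_diff[of x y] nz by (simp add: w q_def)
    qed (use q dense in auto)
  qed (auto simp: s_mero \<Phi>_aut \<Phi>_vec_holomorphic)
  ultimately show ?thesis by (meson equivclp_trans r_into_equivclp)
qed

end

theorem proposition6p11:
  fixes br :: "complex^'n \<Rightarrow> complex^'n \<Rightarrow> complex^'n"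
    and \<sigma> :: "complex^'n \<Rightarrow> complex^'n"
    and m :: nat
    and \<gamma> :: "nat \<Rightarrow> 'n tensor2"
    and g r :: "complex \<times> complex \<Rightarrow> 'n tensor2"
  assumes "simple_lie_algebra br"
    and "coxeter_automorphism br \<sigma>"
    and "has_order \<sigma> m"
    and "\<forall>j<m. \<gamma> j \<in> tensor_subspace (grading_part \<sigma> m (int j)) (grading_part \<sigma> m (- int j))"
    and "casimir br = (\<Sum>j<m. \<gamma> j)"
    and "tensor_holomorphic2_on g UNIV"
    and "\<forall>x y. x ^ m \<noteq> y ^ m \<longrightarrow>
           r (x, y) = (y ^ m / (x ^ m - y ^ m)) *s (\<Sum>j<m. (x / y) ^ j *s \<gamma> j) + g (x, y)"
    and "cybe_two_variables br {(x, y). x ^ m \<noteq> y ^ m} r"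
  shows "\<exists>\<rho>. trigonometric_solution br \<rho> \<and>
           solution_equiv br (r, 0) (\<lambda>(u, v). \<rho> (u - v), 0)"
proof -
  \<comment> \<open>The data defining a Coxeter automorphism include Chevalley generators, from
    which the nonzero value of the Killing form is obtained.\<close>
  obtain N A e f h \<phi> k where chev: "chevalley_generators br N A e f h"
    and kac: "kac_type br N e f h \<phi> 1 (\<lambda>_. 1) k \<sigma>"
    using assms(2) unfolding coxeter_automorphism_def by blast
  obtain a b where "killing br a b \<noteq> 0"
    using killing_nonzero[OF assms(1) chev] by blast
  then interpret nondeg_lie br by (rule nondeg_lieI[OF assms(1)])
  have "lie_automorphism br \<sigma>" using kac by (simp add: kac_type_def Let_def)
  then interpret coxeter_solution br \<sigma> m \<gamma> g r
    using assms(3-8) by unfold_locales auto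
  obtain \<Phi> where "\<Phi> 0 = mat 1" "\<And>z. mat_deriv \<Phi> (- (\<Phi> z ** matrix (br (coxeter_solution.f br m \<gamma> g z)))) z"
    "\<And>z. lie_automorphism br ((*v) (\<Phi> z))"
    using gauge_exists[OF f_holomorphic] by blast
  then interpret gauged_coxeter_solution br \<sigma> m \<gamma> g r \<Phi>
    by unfold_locales
  show ?thesis using \<rho>_trigonometric r_equiv_\<rho> by blast
qed

end
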